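(* Let $\mathbb{F}\in\{\mathbb{R},\mathbb{C},\mathbb{H}\}$ and let $\overset{\circ}{\mathcal{H}}$ be the manifold of $n\times n$ hermitian matrices over $\mathbb{F}$ with pairwise distinct eigenvalues, with the Frobenius metric. Let the unitary group $U(n)=U(n,\mathbb{F})$ act on $\overset{\circ}{\mathcal{H}}$ by $(U,S)\mapsto USU^*$, and let $\phi:\overset{\circ}{\mathcal{H}}\to\overset{\circ}{\mathcal{H}}/U(n)$ be the quotient map. Then $\phi$ is a Riemannian submersion, where the quotient manifold is isometric to the Weyl chamber $\mathcal{W}=\{(\lambda_1,\dots,\lambda_n)\in\mathbb{R}^n : \lambda_1>\cdots>\lambda_n\}$ with the Euclidean metric of $\mathbb{R}^n$ (via $(\lambda_1,\dots,\lambda_n)\mapsto U(n)\cdot\operatorname{diag}(\lambda_1,\dots,\lambda_n)$).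
   Context: $\mathbb{H}$ denotes the quaternions. $A^*$ is the (conjugate) transpose of $A$ over $\mathbb{F}$; a matrix is hermitian if $A=A^*$ (real symmetric, complex hermitian, or quaternion hermitian). $U(n,\mathbb{F})$ is the group of $n\times n$ matrices over $\mathbb{F}$ with $UU^*=I$ (so $O(n)$, the complex unitary group, and the quaternionic unitary group respectively). The Frobenius metric is $\langle A,B\rangle=\operatorname{Re}\operatorname{Tr}(AB^* )$ on the real vector space of hermitian matrices, to which the tangent spaces of the open subset $\overset{\circ}{\mathcal{H}}$ are identified. The quotient carries the natural quotient metric. *)

theory Defs
  imports "HOL-Analysis.Analysis"
begin

section \<open>Quaternions\<close>

datatype quaternion =
  Quaternion (qRe: real) (qI: real) (qJ: real) (qK: real)

lemma quaternion_eq_iff: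
  "x = y \<longleftrightarrow> qRe x = qRe y \<and> qI x = qI y \<and> qJ x = qJ y \<and> qK x = qK y"
  by (cases x; cases y) auto

instantiation quaternion :: ring_1
begin

definition "0 = Quaternion 0 0 0 0"
definition "1 = Quaternion 1 0 0 0"
definition "x + y = Quaternion (qRe x + qRe y) (qI x + qI y) (qJ x + qJ y) (qK x + qK y)"
definition "- x = Quaternion (- qRe x) (- qI x) (- qJ x) (- qK x)"
definition "x - y = Quaternion (qRe x - qRe y) (qI x - qI y) (qJ x - qJ y) (qK x - qK y)"
definition "x * y = Quaternion
  (qRe x * qRe y - qI x * qI y - qJ x * qJ y - qK x * qK y)
  (qRe x * qI y + qI x * qRe y + qJ x * qK y - qK x * qJ y)
  (qRe x * qJ y - qI x * qK y + qJ x * qRe y + qK x * qI y)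
  (qRe x * qK y + qI x * qJ y - qJ x * qI y + qK x * qRe y)"

instance
  apply standard
  apply (simp_all add: quaternion_eq_iff zero_quaternion_def one_quaternion_def plus_quaternion_def
      uminus_quaternion_def minus_quaternion_def times_quaternion_def)
  apply (simp_all add: algebra_simps)
  done

end

instantiation quaternion :: real_vector
begin

definition "scaleR r x = Quaternion (r * qRe x) (r * qI x) (r * qJ x) (r * qK x)"

instance
  by standard
    (simp_all add: quaternion_eq_iff scaleR_quaternion_def plus_quaternion_def algebra_simps)

end

instantiation quaternion :: real_inner
begin

definition "inner x y = qRe x * qRe y + qI x * qI y + qJ x * qJ y + qK x * qK y"
definition "norm (x :: quaternion) = sqrt (inner x x)"
definition "sgn (x :: quaternion) = x /\<^sub>R norm x"
definition "dist (x :: quaternion) y = norm (x - y)"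
definition "(uniformity :: (quaternion \<times> quaternion) filter) =
  (INF e\<in>{0 <..}. principal {(x, y). dist x y < e})"
definition "open (U :: quaternion set) \<longleftrightarrow>
  (\<forall>x\<in>U. eventually (\<lambda>(x', y). x' = x \<longrightarrow> y \<in> U) uniformity)"

instance
proof
  fix x y z :: quaternion and r :: real
  show "inner x y = inner y x" "inner (x + y) z = inner x z + inner y z"
    "inner (r *\<^sub>R x) y = r * inner x y" "0 \<le> inner x x"
    by (auto simp: inner_quaternion_def scaleR_quaternion_def plus_quaternion_def algebra_simps)
  show "inner x x = 0 \<longleftrightarrow> x = 0"
    by (simp_all add: quaternion_eq_iff inner_quaternion_def zero_quaternion_def
        add_nonneg_eq_0_iff)
qed (simp_all only: norm_quaternion_def sgn_quaternion_def dist_quaternion_def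
      uniformity_quaternion_def open_quaternion_def)

end

lemma norm_quaternion_squared:
  "(norm x)\<^sup>2 = (qRe x)\<^sup>2 + (qI x)\<^sup>2 + (qJ x)\<^sup>2 + (qK x)\<^sup>2" for x :: quaternion
  by (simp add: norm_quaternion_def inner_quaternion_def power2_eq_square)

instantiation quaternion :: euclidean_space
begin

definition "Basis = {Quaternion 1 0 0 0, Quaternion 0 1 0 0, Quaternion 0 0 1 0, Quaternion 0 0 0 1}"

instance
proof
  fix u v x :: quaternion
  show "(Basis :: quaternion set) \<noteq> {}" "finite (Basis :: quaternion set)"
    by (simp_all add: Basis_quaternion_def)
  show "inner u v = (if u = v then 1 else 0)" if "u \<in> Basis" "v \<in> Basis"
    using that unfolding Basis_quaternion_def by (elim insertE emptyE) (simp_all add: inner_quaternion_def)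
  show "(\<forall>u\<in>Basis. inner x u = 0) \<longleftrightarrow> x = 0"
    by (cases x) (simp add: Basis_quaternion_def inner_quaternion_def zero_quaternion_def)
qed

end

instantiation quaternion :: real_normed_div_algebra
begin

definition "inverse x = Quaternion (qRe x) (- qI x) (- qJ x) (- qK x) /\<^sub>R (norm x)\<^sup>2"
definition "x div y = x * inverse y" for x y :: quaternion

instance
proof
  fix x y :: quaternion and r :: real
  show "r *\<^sub>R x * y = r *\<^sub>R (x * y)" "x * r *\<^sub>R y = r *\<^sub>R (x * y)"
    by (simp_all add: quaternion_eq_iff scaleR_quaternion_def times_quaternion_def algebra_simps)
  have "(norm (x * y))\<^sup>2 = (norm x * norm y)\<^sup>2"
    unfolding power_mult_distrib norm_quaternion_squared
    by (simp add: times_quaternion_def) algebra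
  then show "norm (x * y) = norm x * norm y"
    by (simp add: power2_eq_iff_nonneg)
  show "x div y = x * inverse y"
    by (simp add: divide_quaternion_def)
  show "inverse (0 :: quaternion) = 0"
    by (simp add: inverse_quaternion_def quaternion_eq_iff scaleR_quaternion_def
        zero_quaternion_def)
  assume "x \<noteq> 0"
  then have nz: "(norm x)\<^sup>2 \<noteq> 0" by simp
  have cr: "Quaternion (qRe x) (- qI x) (- qJ x) (- qK x) * x = (norm x)\<^sup>2 *\<^sub>R 1"
    and cl: "x * Quaternion (qRe x) (- qI x) (- qJ x) (- qK x) = (norm x)\<^sup>2 *\<^sub>R 1"
    unfolding norm_quaternion_squared
    by (simp_all add: quaternion_eq_iff scaleR_quaternion_def times_quaternion_def
        one_quaternion_def power2_eq_square)
  have sl: "(r *\<^sub>R a) * b = r *\<^sub>R (a * b)" "a * (r *\<^sub>R b) = r *\<^sub>R (a * b)"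
    for r and a b :: quaternion
    by (simp_all add: quaternion_eq_iff scaleR_quaternion_def times_quaternion_def algebra_simps)
  show "inverse x * x = 1" "x * inverse x = 1"
    using nz by (simp_all add: inverse_quaternion_def sl cr cl)
qed

end


section \<open>The scalars\<close>

text \<open>
  A common signature for the reals, the complex numbers and the quaternions, so that the matrix
  notions below need to be defined only once.
\<close>

class scalar_algebra = real_normed_div_algebra + euclidean_space +
  fixes fconj :: "'a \<Rightarrow> 'a"
    and fRe :: "'a \<Rightarrow> real"
  assumes fconj_add: "fconj (x + y) = fconj x + fconj y"
    and fconj_mult: "fconj (x * y) = fconj y * fconj x"
    and fconj_fconj: "fconj (fconj x) = x"
    and fconj_scaleR_1: "fconj (r *\<^sub>R 1) = r *\<^sub>R 1"
    and mult_fconj: "x * fconj x = (norm x)\<^sup>2 *\<^sub>R 1"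
    and fRe_scaleR_1: "fRe x *\<^sub>R 1 = (1 / 2) *\<^sub>R (x + fconj x)"
    and inner_eq_fRe: "inner x y = fRe (x * fconj y)"

instantiation real :: scalar_algebra
begin
definition "fconj (x :: real) = x"
definition "fRe (x :: real) = x"
instance
  by standard (simp_all add: fconj_real_def fRe_real_def power2_eq_square)
end

instantiation complex :: scalar_algebra
begin
definition "fconj = cnj"
definition "fRe = Re"
instance
proof
  fix x y :: complex and r :: real
  show "x * fconj x = (norm x)\<^sup>2 *\<^sub>R 1"
    by (simp add: fconj_complex_def complex_mult_cnj cmod_power2 scaleR_conv_of_real)
  show "fRe x *\<^sub>R 1 = (1 / 2) *\<^sub>R (x + fconj x)"
    by (simp add: fconj_complex_def fRe_complex_def complex_eq_iff)
qed (simp_all add: fconj_complex_def fRe_complex_def inner_complex_def)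
end

instantiation quaternion :: scalar_algebra
begin
definition "fconj x = Quaternion (qRe x) (- qI x) (- qJ x) (- qK x)"
definition "fRe = qRe"
instance
proof
  fix x y :: quaternion and r :: real
  show "fconj (x + y) = fconj x + fconj y"
    by (simp add: fconj_quaternion_def plus_quaternion_def)
  show "fconj (x * y) = fconj y * fconj x"
    by (simp add: fconj_quaternion_def times_quaternion_def)
  show "fconj (fconj x) = x" "fconj (r *\<^sub>R 1) = r *\<^sub>R (1 :: quaternion)"
    by (simp_all add: fconj_quaternion_def scaleR_quaternion_def one_quaternion_def)
  show "x * fconj x = (norm x)\<^sup>2 *\<^sub>R 1"
    unfolding norm_quaternion_squared
    by (simp add: fconj_quaternion_def times_quaternion_def scaleR_quaternion_def
        one_quaternion_def power2_eq_square)
  show "fRe x *\<^sub>R 1 = (1 / 2) *\<^sub>R (x + fconj x)"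
    by (simp add: fRe_quaternion_def fconj_quaternion_def plus_quaternion_def
        scaleR_quaternion_def one_quaternion_def)
  show "inner x y = fRe (x * fconj y)"
    by (simp add: inner_quaternion_def fRe_quaternion_def fconj_quaternion_def
        times_quaternion_def)
qed
end


section \<open>Hermitian matrices and the action of the unitary group\<close>

type_synonym ('a, 'n) square_matrix = "(('a, 'n) vec, 'n) vec"

definition conj_transpose :: "'a::scalar_algebra^'n^'n \<Rightarrow> 'a^'n^'n" where
  "conj_transpose A = (\<chi> i j. fconj (A $ j $ i))"

definition hermitian_matrices :: "('a::scalar_algebra^'n^'n) set" where
  "hermitian_matrices = {A. conj_transpose A = A}"

definition unitary_group :: "('a::scalar_algebra^'n^'n) set" where
  "unitary_group = {U. U ** conj_transpose U = mat 1}"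

definition frobenius :: "'a::scalar_algebra^'n^'n \<Rightarrow> 'a^'n^'n \<Rightarrow> real" where
  "frobenius A B = fRe (trace (A ** conj_transpose B))"

text \<open>
  Eigenvalues are right eigenvalues, the usual convention over the quaternions (left eigenvalues
  of a quaternion hermitian matrix need not be real).
\<close>

definition eigenvalues :: "'a::scalar_algebra^'n^'n \<Rightarrow> 'a set" where
  "eigenvalues A = {l. \<exists>v. v \<noteq> 0 \<and> A *v v = (\<chi> i. v $ i * l)}"

text \<open>
  The \<open>n\<close> eigenvalues of a hermitian matrix, counted with multiplicity, are pairwise distinct
  iff the set of eigenvalues has \<open>n\<close> elements.
\<close>

definition simple_hermitian :: "('a::scalar_algebra^'n^'n) set" where
  "simple_hermitian = {A \<in> hermitian_matrices. card (eigenvalues A) = CARD('n)}"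

definition unitary_orbit :: "'a::scalar_algebra^'n^'n \<Rightarrow> ('a^'n^'n) set" where
  "unitary_orbit S = {U ** S ** conj_transpose U |U. U \<in> unitary_group}"

definition diag :: "real^'n \<Rightarrow> 'a::scalar_algebra^'n^'n" where
  "diag l = (\<chi> i j. if i = j then of_real (l $ i) else 0)"

definition weyl_chamber :: "(real^'n::{finite,linorder}) set" where
  "weyl_chamber = {l. \<forall>i j. i < j \<longrightarrow> l $ i > l $ j}"


section \<open>Smooth maps on relatively open subsets of a linear subspace\<close>

text \<open>
  Here \<open>S\<close> is meant to be open in the linear subspace \<open>V\<close>. The derivative at a point of \<open>S\<close>
  within \<open>S\<close> is then uniquely determined on \<open>V\<close>, and only its values on \<open>V\<close> are used. A map is
  of class \<open>C\<^sup>k\<^sup>+\<^sup>1\<close> iff it is differentiable and all its directional derivatives are of class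
  \<open>C\<^sup>k\<close>.
\<close>

primrec Ck_on ::
  "nat \<Rightarrow> 'a::euclidean_space set \<Rightarrow> 'a set \<Rightarrow> ('a \<Rightarrow> 'b::euclidean_space) \<Rightarrow> bool" where
  "Ck_on 0 V S f \<longleftrightarrow> continuous_on S f"
| "Ck_on (Suc k) V S f \<longleftrightarrow>
     (\<exists>f'. (\<forall>x\<in>S. (f has_derivative f' x) (at x within S)) \<and>
           (\<forall>v\<in>V. Ck_on k V S (\<lambda>x. f' x v)))"

definition smooth_on ::
  "'a::euclidean_space set \<Rightarrow> 'a set \<Rightarrow> ('a \<Rightarrow> 'b::euclidean_space) \<Rightarrow> bool" where
  "smooth_on V S f \<longleftrightarrow> (\<forall>k. Ck_on k V S f)"


section \<open>Riemannian manifolds\<close>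

text \<open>
  A chart is a pair of its domain and its coordinate map. A manifold is modelled on a linear
  subspace of a Euclidean space, so that the hermitian matrices can serve as a model space
  without being a type. Tangent vectors are represented by their coordinates in a chart, that is,
  by vectors of the model space; \<open>mmetric M C p u v\<close> is the inner product at \<open>p\<close> of the tangent
  vectors with coordinates \<open>u\<close> and \<open>v\<close> in the chart \<open>C\<close>.
\<close>

type_synonym ('m, 'e) chart = "'m set \<times> ('m \<Rightarrow> 'e)"

record ('m, 'e) rmanifold =
  mtopology :: "'m topology"
  mmodel :: "'e set"
  matlas :: "('m, 'e) chart set"
  mmetric :: "('m, 'e) chart \<Rightarrow> 'm \<Rightarrow> 'e \<Rightarrow> 'e \<Rightarrow> real"

text \<open>The coordinate expression of \<open>f\<close> and of its differential at \<open>p\<close>.\<close>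

definition coord_domain :: "('m \<Rightarrow> 'k) \<Rightarrow> ('m, 'e) chart \<Rightarrow> ('k, 'd) chart \<Rightarrow> 'e set" where
  "coord_domain f C D = snd C ` (fst C \<inter> f -` fst D)"

definition coord_map :: "('m \<Rightarrow> 'k) \<Rightarrow> ('m, 'e) chart \<Rightarrow> ('k, 'd) chart \<Rightarrow> 'e \<Rightarrow> 'd" where
  "coord_map f C D = snd D \<circ> f \<circ> inv_into (fst C) (snd C)"

definition differential ::
  "('m \<Rightarrow> 'k) \<Rightarrow> ('m, 'e::euclidean_space) chart \<Rightarrow> ('k, 'd::euclidean_space) chart \<Rightarrow> 'm \<Rightarrow> 'e \<Rightarrow> 'd"
  where
  "differential f C D p =
     frechet_derivative (coord_map f C D) (at (snd C p) within coord_domain f C D)"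

definition smooth_manifold :: "('m, 'e::euclidean_space) rmanifold \<Rightarrow> bool" where
  "smooth_manifold M \<longleftrightarrow>
     Hausdorff_space (mtopology M) \<and> second_countable (mtopology M) \<and>
     subspace (mmodel M) \<and>
     topspace (mtopology M) = (\<Union>C\<in>matlas M. fst C) \<and>
     (\<forall>(U, c)\<in>matlas M.
        openin (mtopology M) U \<and>
        openin (top_of_set (mmodel M)) (c ` U) \<and>
        homeomorphic_map (subtopology (mtopology M) U) (top_of_set (c ` U)) c) \<and>
     (\<forall>C\<in>matlas M. \<forall>D\<in>matlas M.
        smooth_on (mmodel M) (coord_domain id C D) (coord_map id C D))"

definition inner_product_on :: "'e::real_vector set \<Rightarrow> ('e \<Rightarrow> 'e \<Rightarrow> real) \<Rightarrow> bool" where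
  "inner_product_on V g \<longleftrightarrow>
     (\<forall>u\<in>V. \<forall>v\<in>V. g u v = g v u) \<and>
     (\<forall>u\<in>V. \<forall>v\<in>V. \<forall>w\<in>V. g (u + v) w = g u w + g v w) \<and>
     (\<forall>u\<in>V. \<forall>v\<in>V. \<forall>r. g (r *\<^sub>R u) v = r * g u v) \<and>
     (\<forall>u\<in>V. u \<noteq> 0 \<longrightarrow> g u u > 0)"

definition riemannian_manifold :: "('m, 'e::euclidean_space) rmanifold \<Rightarrow> bool" where
  "riemannian_manifold M \<longleftrightarrow>
     smooth_manifold M \<and>
     (\<forall>C\<in>matlas M. \<forall>p\<in>fst C. inner_product_on (mmodel M) (mmetric M C p)) \<and>
     (\<forall>C\<in>matlas M. \<forall>u\<in>mmodel M. \<forall>v\<in>mmodel M.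
        smooth_on (mmodel M) (snd C ` fst C)
          (\<lambda>x. mmetric M C (inv_into (fst C) (snd C) x) u v)) \<and>
     (\<forall>C\<in>matlas M. \<forall>D\<in>matlas M. \<forall>p\<in>fst C \<inter> fst D. \<forall>u\<in>mmodel M. \<forall>v\<in>mmodel M.
        mmetric M D p (differential id C D p u) (differential id C D p v) = mmetric M C p u v)"

definition smooth_map ::
  "('m, 'e::euclidean_space) rmanifold \<Rightarrow> ('k, 'd::euclidean_space) rmanifold \<Rightarrow> ('m \<Rightarrow> 'k) \<Rightarrow> bool"
  where
  "smooth_map M N f \<longleftrightarrow>
     continuous_map (mtopology M) (mtopology N) f \<and>
     (\<forall>C\<in>matlas M. \<forall>D\<in>matlas N.
        smooth_on (mmodel M) (coord_domain f C D) (coord_map f C D))"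

text \<open>
  The differential of a Riemannian submersion is surjective, and isometric on the horizontal
  space, the orthogonal complement of its kernel.
\<close>

definition horizontal ::
  "('m, 'e::euclidean_space) rmanifold \<Rightarrow> ('m \<Rightarrow> 'k) \<Rightarrow>
     ('m, 'e) chart \<Rightarrow> ('k, 'd::euclidean_space) chart \<Rightarrow> 'm \<Rightarrow> 'e set" where
  "horizontal M f C D p =
     {u \<in> mmodel M. \<forall>w\<in>mmodel M. differential f C D p w = 0 \<longrightarrow> mmetric M C p u w = 0}"

definition riemannian_submersion ::
  "('m, 'e::euclidean_space) rmanifold \<Rightarrow> ('k, 'd::euclidean_space) rmanifold \<Rightarrow> ('m \<Rightarrow> 'k) \<Rightarrow> bool"
  where
  "riemannian_submersion M N f \<longleftrightarrow>
     riemannian_manifold M \<and> riemannian_manifold N \<and> smooth_map M N f \<and>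
     (\<forall>C\<in>matlas M. \<forall>D\<in>matlas N. \<forall>p\<in>fst C \<inter> f -` fst D.
        differential f C D p ` mmodel M = mmodel N \<and>
        (\<forall>u\<in>horizontal M f C D p. \<forall>v\<in>horizontal M f C D p.
           mmetric N D (f p) (differential f C D p u) (differential f C D p v)
             = mmetric M C p u v))"

definition riemannian_isometry ::
  "('m, 'e::euclidean_space) rmanifold \<Rightarrow> ('k, 'd::euclidean_space) rmanifold \<Rightarrow> ('m \<Rightarrow> 'k) \<Rightarrow> bool"
  where
  "riemannian_isometry M N f \<longleftrightarrow>
     riemannian_manifold M \<and> riemannian_manifold N \<and>
     bij_betw f (topspace (mtopology M)) (topspace (mtopology N)) \<and>
     smooth_map M N f \<and> smooth_map N M (inv_into (topspace (mtopology M)) f) \<and>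
     (\<forall>C\<in>matlas M. \<forall>D\<in>matlas N. \<forall>p\<in>fst C \<inter> f -` fst D. \<forall>u\<in>mmodel M. \<forall>v\<in>mmodel M.
        mmetric N D (f p) (differential f C D p u) (differential f C D p v) = mmetric M C p u v)"

text \<open>
  \<open>Q\<close> is a quotient of \<open>M\<close> along \<open>f\<close>: it carries the quotient topology, the (unique) smooth
  structure for which \<open>f\<close> is a submersion and the (unique) quotient metric, for which horizontal
  vectors keep their inner products.
\<close>

definition riemannian_quotient ::
  "('m, 'e::euclidean_space) rmanifold \<Rightarrow> ('m \<Rightarrow> 'k) \<Rightarrow> ('k, 'd::euclidean_space) rmanifold \<Rightarrow> bool"
  where
  "riemannian_quotient M f Q \<longleftrightarrow>
     quotient_map (mtopology M) (mtopology Q) f \<and> riemannian_submersion M Q f"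

definition open_rmanifold ::
  "'e::euclidean_space set \<Rightarrow> 'e set \<Rightarrow> ('e \<Rightarrow> 'e \<Rightarrow> real) \<Rightarrow> ('e, 'e) rmanifold" where
  "open_rmanifold V S g =
     \<lparr>mtopology = top_of_set S, mmodel = V, matlas = {(S, id)}, mmetric = (\<lambda>C p. g)\<rparr>"

definition simple_hermitian_manifold ::
  "('a::scalar_algebra^'n^'n, 'a^'n^'n) rmanifold" where
  "simple_hermitian_manifold = open_rmanifold hermitian_matrices simple_hermitian frobenius"

definition weyl_manifold ::
  "(real^'n::{finite,linorder}, real^'n::{finite,linorder}) rmanifold" where
  "weyl_manifold = open_rmanifold UNIV weyl_chamber inner"

end

theory Submission
  imports Defs
begin

text \<open>
  The quotient map is essentially the map \<open>\<lambda>\<close> that sends a matrix to its decreasing list of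
  eigenvalues, and \<open>diag\<close> is a section of it that is isometric for the Frobenius metric. Everything
  is proved for an arbitrary scalar algebra, of which the reals, the complex numbers and the
  quaternions are instances.

  A hermitian matrix with \<open>n\<close> distinct eigenvalues is \<open>U diag(\<lambda>) U\<^sup>*\<close>, since its eigenvectors are
  orthogonal (\<open>hermitian_diagonalization\<close>). So orbits correspond to points of the Weyl chamber, and
  the orbit map is \<open>\<lambda>\<close> followed by the bijection \<open>\<psi> : l \<mapsto> U(n) \<cdot> diag(l)\<close>.

  The analytic core is the smoothness of \<open>\<lambda>\<close>. A self-adjoint map has an eigenvalue near \<open>c\<close> as soon
  as it nearly maps some unit vector \<open>v\<close> to \<open>c v\<close> (\<open>selfadjoint_eigenvalue_near\<close>). Hence, close to
  a matrix with simple spectrum, every hermitian matrix has an eigenvalue near each of the \<open>n\<close> given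
  ones; so it has simple spectrum too, and \<open>\<lambda>\<close> is continuous (\<open>simple_hermitian_perturbation\<close>). The
  spectral projection \<open>P\<^sub>i(A)\<close> is a Lagrange polynomial in \<open>A\<close> and therefore as smooth as \<open>\<lambda>\<close>. The
  identity
  \<open>(\<lambda>\<^sub>i(B) - \<lambda>\<^sub>i(A)) \<langle>P\<^sub>i(B), P\<^sub>i(A)\<rangle> = \<langle>P\<^sub>i(B), (B - A) P\<^sub>i(A)\<rangle>\<close>
  shows that \<open>\<lambda>\<^sub>i\<close> is differentiable with gradient \<open>P\<^sub>i\<close>. So if \<open>\<lambda>\<close> is \<open>C\<^sup>k\<close>, then its gradients are
  \<open>C\<^sup>k\<close> and \<open>\<lambda>\<close> is \<open>C\<^sup>k\<^sup>+\<^sup>1\<close>. The gradients \<open>P\<^sub>1(A), \<dots>, P\<^sub>n(A)\<close> are orthonormal, which says exactly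
  that \<open>d\<lambda>\<close> is surjective and isometric on the orthogonal complement of its kernel. Transporting
  the structure of the Weyl chamber to the orbits along \<open>\<psi>\<close> thus gives a Riemannian quotient
  (\<open>riemannian_quotient_orbit_manifold\<close>).

  Now let \<open>Q\<close> be any Riemannian quotient, and \<open>\<phi>\<close> the orbit map into it. Then \<open>\<psi> = \<phi> \<circ> diag\<close> is
  smooth, its inverse is continuous because \<open>Q\<close> carries the quotient topology, and the chain rule
  for \<open>\<phi> = \<psi> \<circ> \<lambda>\<close> gives \<open>d\<phi> = d\<psi> \<circ> d\<lambda>\<close>. So \<open>d\<psi>\<close> is onto, and by invariance of domain \<open>Q\<close> has
  dimension at least \<open>n\<close>; hence \<open>d\<psi>\<close> is bijective and \<open>d\<phi>\<close> has the same kernel as \<open>d\<lambda>\<close>. At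
  diagonal matrices the diagonal directions are orthogonal to that kernel, so they are horizontal,
  and \<open>\<psi>\<close> preserves the metric (\<open>mmetric_dg\<close>). Finally the inverse of \<open>d\<psi>\<close> is its adjoint, an
  expression that is as smooth as the metric of \<open>Q\<close> and \<open>\<psi>\<^sup>-\<^sup>1\<close>; this bootstraps \<open>\<psi>\<^sup>-\<^sup>1\<close> from
  continuous to smooth (\<open>smooth_h\<close>).
\<close>

section \<open>Calculus of smooth maps on open subsets of a subspace\<close>

lemma Ck_on_cong:
  assumes "\<And>x. x \<in> S \<Longrightarrow> f x = g x"
  shows "Ck_on k V S f \<longleftrightarrow> Ck_on k V S g"
proof (cases k)
  case 0
  then show ?thesis using assms by (simp cong: continuous_on_cong)
next
  case (Suc m)
  have "(f has_derivative f') (at x within S) \<longleftrightarrow> (g has_derivative f') (at x within S)"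
    if "x \<in> S" for x f'
    using assms that by (metis has_derivative_transform)
  then show ?thesis by (simp add: Suc)
qed

text \<open>
  From a point of \<open>S\<close> one can move inside \<open>S\<close> a little in every direction of \<open>V\<close>, and along such a
  segment the derivative is that of a curve on an open interval.
\<close>

lemma derivative_unique_on_subspace:
  fixes f :: "'a::euclidean_space \<Rightarrow> 'b::euclidean_space"
  assumes S: "openin (top_of_set V) S" and V: "subspace V" and x: "x \<in> S" and v: "v \<in> V"
    and f': "(f has_derivative f') (at x within S)"
    and f'': "(f has_derivative f'') (at x within S)"
  shows "f' v = f'' v"
proof -
  obtain O' where O: "open O'" "S = V \<inter> O'"
    using S by (auto simp: openin_open)
  define c where "c = (\<lambda>t::real. x + t *\<^sub>R v)"
  define T where "T = c -` O'"
  have T: "open T"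
    unfolding T_def c_def by (intro open_vimage O continuous_intros)
  have xV: "x \<in> V" using x O by auto
  have 0: "0 \<in> T" using x O by (auto simp: T_def c_def)
  have cT: "c ` T \<subseteq> S"
    using O xV v V by (auto simp: T_def c_def subspace_add subspace_scale)
  have c: "(c has_derivative (\<lambda>t. t *\<^sub>R v)) (at 0)"
    unfolding c_def by (auto intro!: derivative_eq_intros)
  have "((f \<circ> c) has_derivative (g \<circ> (\<lambda>t. t *\<^sub>R v))) (at 0)"
    if "(f has_derivative g) (at x within S)" for g
  proof -
    have "(f has_derivative g) (at (c 0) within c ` T)"
      using has_derivative_subset[OF that cT] by (simp add: c_def)
    with has_derivative_at_withinI[OF c] have
      "((f \<circ> c) has_derivative (g \<circ> (\<lambda>t. t *\<^sub>R v))) (at 0 within T)"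
      by (rule diff_chain_within)
    then show ?thesis by (simp only: at_within_open[OF 0 T])
  qed
  from has_derivative_unique[OF this[OF f'] this[OF f'']]
  show ?thesis by (metis comp_apply scaleR_one)
qed

text \<open>
  The derivative in the definition of \<^const>\<open>Ck_on\<close> may be chosen anew for every \<open>k\<close>; by
  uniqueness, any choice of the derivative may be used instead.
\<close>

lemma Ck_on_SucD:
  assumes S: "openin (top_of_set V) S" and V: "subspace V"
    and "Ck_on (Suc k) V S f" and F: "\<And>x. x \<in> S \<Longrightarrow> (f has_derivative F x) (at x within S)"
    and v: "v \<in> V"
  shows "Ck_on k V S (\<lambda>x. F x v)"
proof -
  obtain f' where f': "\<And>x. x \<in> S \<Longrightarrow> (f has_derivative f' x) (at x within S)"
    "Ck_on k V S (\<lambda>x. f' x v)"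
    using assms by auto
  have "f' x v = F x v" if "x \<in> S" for x
    using derivative_unique_on_subspace[OF S V that v f'(1)[OF that] F[OF that]] .
  then show ?thesis using f'(2) Ck_on_cong[of S "\<lambda>x. f' x v"] by auto
qed

lemma Ck_on_SucI:
  assumes "\<And>x. x \<in> S \<Longrightarrow> (f has_derivative F x) (at x within S)"
    and "\<And>v. v \<in> V \<Longrightarrow> Ck_on k V S (\<lambda>x. F x v)"
  shows "Ck_on (Suc k) V S f"
  using assms by auto

lemma Ck_on_SucE:
  assumes "Ck_on (Suc k) V S f"
  obtains f' where "\<And>x. x \<in> S \<Longrightarrow> (f has_derivative f' x) (at x within S)"
    and "\<And>v. v \<in> V \<Longrightarrow> Ck_on k V S (\<lambda>x. f' x v)"
  using assms unfolding Ck_on.simps by blast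

lemma Ck_on_Suc_imp: "Ck_on (Suc k) V S f \<Longrightarrow> Ck_on k V S f"
proof (induction k arbitrary: f)
  case 0
  then show ?case by (auto intro: has_derivative_continuous_on)
next
  case (Suc k)
  from Suc.prems obtain f'
    where f': "\<And>x. x \<in> S \<Longrightarrow> (f has_derivative f' x) (at x within S)"
      "\<And>v. v \<in> V \<Longrightarrow> Ck_on (Suc k) V S (\<lambda>x. f' x v)"
    by (elim Ck_on_SucE) blast
  show ?case
    by (rule Ck_on_SucI[OF f'(1)], assumption) (intro f'(2) Suc.IH)
qed

lemma Ck_on_const [simp]: "Ck_on k V S (\<lambda>x. c)"
  by (induction k arbitrary: c) (auto intro!: exI[of _ "\<lambda>x h. 0"])

lemma Ck_on_linear:
  assumes L: "bounded_linear L"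
  shows "Ck_on k V S L"
proof (cases k)
  case 0
  then show ?thesis using L by (simp add: linear_continuous_on)
next
  case (Suc m)
  then show ?thesis
    using bounded_linear_imp_has_derivative[OF L] by (auto intro!: exI[of _ "\<lambda>x. L"])
qed

lemma Ck_on_linear_image:
  assumes L: "bounded_linear L" and "Ck_on k V S f"
  shows "Ck_on k V S (\<lambda>x. L (f x))"
  using assms(2)
proof (induction k arbitrary: f)
  case 0
  then show ?case
    using linear_continuous_on_compose[of S f L] L by (simp add: bounded_linear.linear)
next
  case (Suc k)
  from Suc.prems(1) obtain f'
    where f': "\<And>x. x \<in> S \<Longrightarrow> (f has_derivative f' x) (at x within S)"
      "\<And>v. v \<in> V \<Longrightarrow> Ck_on k V S (\<lambda>x. f' x v)"
    by (elim Ck_on_SucE) blast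
  show ?case
    by (rule Ck_on_SucI[OF bounded_linear.has_derivative[OF L f'(1)]], assumption) (intro f'(2) Suc.IH)
qed

text \<open>
  This covers maps between different subspaces, such as the diagonal embedding of \<open>\<real>\<^sup>n\<close> into the
  hermitian matrices; \<open>Ck_on_compose\<close> below treats nonlinear inner maps, into a full space.
\<close>

lemma Ck_on_linear_substitution:
  assumes L: "bounded_linear L" and LS: "L ` S' \<subseteq> S" and LV: "L ` V' \<subseteq> V" and "Ck_on k V S f"
  shows "Ck_on k V' S' (\<lambda>x. f (L x))"
  using assms(4)
proof (induction k arbitrary: f)
  case 0
  then show ?case
    using continuous_on_compose2[of S f S' L] LS linear_continuous_on[OF L] by simp
next
  case (Suc k)
  from Suc.prems(1) obtain f'
    where f': "\<And>x. x \<in> S \<Longrightarrow> (f has_derivative f' x) (at x within S)"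
      "\<And>v. v \<in> V \<Longrightarrow> Ck_on k V S (\<lambda>x. f' x v)"
    by (elim Ck_on_SucE) blast
  show ?case
  proof (rule Ck_on_SucI)
    show "((\<lambda>x. f (L x)) has_derivative (\<lambda>h. f' (L x) (L h))) (at x within S')" if "x \<in> S'" for x
      using has_derivative_in_compose2[of S f f' L S' x L] f'(1) LS that
        bounded_linear_imp_has_derivative[OF L] by (auto simp: o_def)
    show "Ck_on k V' S' (\<lambda>x. f' (L x) (L v))" if "v \<in> V'" for v
      using Suc.IH[of "\<lambda>x. f' x (L v)"] f'(2)[of "L v"] LV that by auto
  qed
qed

lemma Ck_on_add:
  assumes "Ck_on k V S f" "Ck_on k V S g"
  shows "Ck_on k V S (\<lambda>x. f x + g x)"
  using assms
proof (induction k arbitrary: f g)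
  case 0
  then show ?case by (simp add: continuous_on_add)
next
  case (Suc k)
  from Suc.prems(1) obtain f'
    where f': "\<And>x. x \<in> S \<Longrightarrow> (f has_derivative f' x) (at x within S)"
      "\<And>v. v \<in> V \<Longrightarrow> Ck_on k V S (\<lambda>x. f' x v)"
    by (elim Ck_on_SucE) blast
  from Suc.prems(2) obtain g'
    where g': "\<And>x. x \<in> S \<Longrightarrow> (g has_derivative g' x) (at x within S)"
      "\<And>v. v \<in> V \<Longrightarrow> Ck_on k V S (\<lambda>x. g' x v)"
    by (elim Ck_on_SucE) blast
  show ?case
    by (rule Ck_on_SucI[OF has_derivative_add[OF f'(1) g'(1)]], assumption+)
      (intro f'(2) g'(2) Suc.IH)
qed

lemma Ck_on_sum:
  "(\<And>i. i \<in> I \<Longrightarrow> Ck_on k V S (f i)) \<Longrightarrow> Ck_on k V S (\<lambda>x. \<Sum>i\<in>I. f i x)"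
  by (induction I rule: infinite_finite_induct) (auto intro!: Ck_on_add)

lemma Ck_on_bilinear:
  assumes "bounded_bilinear m" and "Ck_on k V S f" "Ck_on k V S g"
  shows "Ck_on k V S (\<lambda>x. m (f x) (g x))"
proof -
  interpret bounded_bilinear m by fact
  show ?thesis
    using assms(2,3)
  proof (induction k arbitrary: f g)
    case 0
    then show ?case by (simp add: continuous_on)
  next
    case (Suc k)
    from Suc.prems(1) obtain f'
      where f': "\<And>x. x \<in> S \<Longrightarrow> (f has_derivative f' x) (at x within S)"
        "\<And>v. v \<in> V \<Longrightarrow> Ck_on k V S (\<lambda>x. f' x v)"
      by (elim Ck_on_SucE) blast
    from Suc.prems(2) obtain g'
      where g': "\<And>x. x \<in> S \<Longrightarrow> (g has_derivative g' x) (at x within S)"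
        "\<And>v. v \<in> V \<Longrightarrow> Ck_on k V S (\<lambda>x. g' x v)"
      by (elim Ck_on_SucE) blast
    show ?case
      by (rule Ck_on_SucI[OF FDERIV[OF f'(1) g'(1)]], assumption+)
        (intro Ck_on_add Suc.IH f'(2) g'(2) Suc.prems[THEN Ck_on_Suc_imp])
  qed
qed

lemma Ck_on_inverse:
  fixes f :: "'a::euclidean_space \<Rightarrow> real"
  assumes "Ck_on k V S f" "\<And>x. x \<in> S \<Longrightarrow> f x \<noteq> 0"
  shows "Ck_on k V S (\<lambda>x. inverse (f x))"
  using assms(1)
proof (induction k)
  case 0
  then show ?case using assms(2) by (simp add: continuous_on_inverse)
next
  case (Suc k)
  from Suc.prems(1) obtain f'
    where f': "\<And>x. x \<in> S \<Longrightarrow> (f has_derivative f' x) (at x within S)"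
      "\<And>v. v \<in> V \<Longrightarrow> Ck_on k V S (\<lambda>x. f' x v)"
    by (elim Ck_on_SucE) blast
  have i: "Ck_on k V S (\<lambda>x. inverse (f x))"
    using Suc.IH Suc.prems Ck_on_Suc_imp by blast
  show ?case
  proof (rule Ck_on_SucI)
    show "((\<lambda>x. inverse (f x)) has_derivative (\<lambda>h. - (inverse (f x) * f' x h * inverse (f x))))
        (at x within S)" if "x \<in> S" for x
      using assms(2)[OF that] f'(1)[OF that] by (rule Deriv.has_derivative_inverse)
    show "Ck_on k V S (\<lambda>x. - (inverse (f x) * f' x v * inverse (f x)))" if "v \<in> V" for v
      by (intro Ck_on_linear_image[OF bounded_linear_minus[OF bounded_linear_ident]]
          Ck_on_bilinear[OF bounded_bilinear_mult] i f'(2) that)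
  qed
qed

lemma Ck_on_compose:
  fixes f :: "'a::euclidean_space \<Rightarrow> 'b::euclidean_space" and g :: "'b \<Rightarrow> 'c::euclidean_space"
  assumes "Ck_on k V S f" "Ck_on k UNIV T g" and ST: "f ` S \<subseteq> T"
  shows "Ck_on k V S (\<lambda>x. g (f x))"
  using assms(1,2)
proof (induction k arbitrary: g)
  case 0
  then show ?case using continuous_on_compose2[of T g S f] ST by simp
next
  case (Suc k)
  from Suc.prems(1) obtain f'
    where f': "\<And>x. x \<in> S \<Longrightarrow> (f has_derivative f' x) (at x within S)"
      "\<And>v. v \<in> V \<Longrightarrow> Ck_on k V S (\<lambda>x. f' x v)"
    by (elim Ck_on_SucE) blast
  from Suc.prems(2) obtain g'
    where g': "\<And>x. x \<in> T \<Longrightarrow> (g has_derivative g' x) (at x within T)"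
      "\<And>v. v \<in> UNIV \<Longrightarrow> Ck_on k UNIV T (\<lambda>x. g' x v)"
    by (elim Ck_on_SucE) blast
  show ?case
  proof (rule Ck_on_SucI)
    \<comment> \<open>expanding the inner derivative in a basis leaves only directional derivatives of the outer
      map in constant directions, to which the induction hypothesis applies\<close>
    show "((\<lambda>x. g (f x)) has_derivative (\<lambda>h. \<Sum>b\<in>Basis. inner (f' x h) b *\<^sub>R g' (f x) b))
        (at x within S)" if x: "x \<in> S" for x
    proof -
      have fx: "f x \<in> T" using x ST by auto
      have "(\<lambda>h. g' (f x) (f' x h)) = (\<lambda>h. \<Sum>b\<in>Basis. inner (f' x h) b *\<^sub>R g' (f x) b)"
      proof
        fix h
        have l: "linear (g' (f x))" using g'(1)[OF fx] by (rule has_derivative_linear)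
        show "g' (f x) (f' x h) = (\<Sum>b\<in>Basis. inner (f' x h) b *\<^sub>R g' (f x) b)"
          by (subst euclidean_representation[of "f' x h", symmetric])
            (simp only: linear_sum[OF l] linear_scale[OF l])
      qed
      moreover have "((\<lambda>x. g (f x)) has_derivative (\<lambda>h. g' (f x) (f' x h))) (at x within S)"
        by (rule has_derivative_in_compose2[OF g'(1) ST x f'(1)[OF x]])
      ultimately show ?thesis by simp
    qed
    show "Ck_on k V S (\<lambda>x. \<Sum>b\<in>Basis. inner (f' x v) b *\<^sub>R g' (f x) b)" if "v \<in> V" for v
      by (intro Ck_on_sum Ck_on_bilinear[OF bounded_bilinear_scaleR]
          Ck_on_linear_image[OF bounded_linear_inner_left] f'(2) that
          Suc.IH[of "\<lambda>x. g' x _"] g'(2) UNIV_I Suc.prems(1)[THEN Ck_on_Suc_imp])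
  qed
qed

lemma openin_top_of_set_UNIV: "openin (top_of_set UNIV) S \<longleftrightarrow> open S"
  by (simp add: openin_open)

lemma smooth_on_cong:
  "(\<And>x. x \<in> S \<Longrightarrow> f x = g x) \<Longrightarrow> smooth_on V S f \<longleftrightarrow> smooth_on V S g"
  unfolding smooth_on_def using Ck_on_cong by metis

lemma smooth_on_has_derivative:
  assumes "smooth_on V S f" "x \<in> S"
  shows "(f has_derivative frechet_derivative f (at x within S)) (at x within S)"
proof -
  from assms(1) have "Ck_on (Suc 0) V S f" unfolding smooth_on_def by blast
  then obtain f' where "\<And>x. x \<in> S \<Longrightarrow> (f has_derivative f' x) (at x within S)"
    by (elim Ck_on_SucE) blast
  then show ?thesis
    using assms(2) differentiableI frechet_derivative_works by blast
qed

section \<open>Scalars\<close>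

lemma norm_fconj [simp]: "norm (fconj (x::'a::scalar_algebra)) = norm x"
proof (cases "x = 0")
  case True
  have "fconj (0::'a) = 0" using fconj_scaleR_1[of 0] by simp
  then show ?thesis using True by simp
next
  case False
  have "norm x * norm (fconj x) = norm (x * fconj x)" by (simp add: norm_mult)
  also have "\<dots> = norm x * norm x" by (simp add: mult_fconj power2_eq_square)
  finally show ?thesis using False by simp
qed

lemma fconj_scaleR [simp]: "fconj (r *\<^sub>R x) = r *\<^sub>R fconj (x::'a::scalar_algebra)"
proof -
  have "fconj (r *\<^sub>R x) = fconj ((r *\<^sub>R 1) * x)" by simp
  also have "\<dots> = fconj x * (r *\<^sub>R 1)" by (simp only: fconj_mult fconj_scaleR_1)
  finally show ?thesis by simp
qed

lemma fconj_0 [simp]: "fconj (0::'a::scalar_algebra) = 0"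
  using fconj_scaleR_1[of 0, where 'a='a] by simp

lemma fconj_1 [simp]: "fconj (1::'a::scalar_algebra) = 1"
  using fconj_scaleR_1[of 1, where 'a='a] by simp

lemma fconj_of_real [simp]: "fconj (of_real r :: 'a::scalar_algebra) = of_real r"
  by (simp add: of_real_def)

lemma fconj_sum: "fconj (sum f I) = (\<Sum>i\<in>I. fconj (f i :: 'a::scalar_algebra))"
  by (induction I rule: infinite_finite_induct) (simp_all add: fconj_add)

lemma fconj_mult_self: "fconj x * x = (norm x)\<^sup>2 *\<^sub>R (1::'a::scalar_algebra)"
  using mult_fconj[of "fconj x"] by (simp add: fconj_fconj)

lemma linear_fRe: "linear (fRe :: 'a::scalar_algebra \<Rightarrow> real)"
proof
  show "fRe (x + y) = fRe x + fRe y" for x y :: 'a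
    using inner_eq_fRe[of "x + y" 1] inner_eq_fRe[of x 1] inner_eq_fRe[of y 1]
    by (simp add: inner_add_left)
  show "fRe (r *\<^sub>R x) = r *\<^sub>R fRe x" for x :: 'a and r
    using inner_eq_fRe[of "r *\<^sub>R x" 1] inner_eq_fRe[of x 1] by simp
qed

lemma inner_fconj_fconj: "inner (fconj x) (fconj y) = inner x (y::'a::scalar_algebra)"
proof -
  have "(norm (fconj (x + y)))\<^sup>2 = (norm (x + y))\<^sup>2" by simp
  then show ?thesis
    by (simp add: fconj_add power2_norm_eq_inner inner_add_left inner_add_right inner_commute)
      (simp add: power2_norm_eq_inner[symmetric])
qed

text \<open>
  Real parts of products are invariant under cyclic permutation even if the scalars do not
  commute, because conjugation preserves the real inner product.
\<close>

lemma inner_mult_left_fconj: "inner (a * x) y = inner x (fconj a * (y::'a::scalar_algebra))"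
proof -
  have "inner (a * x) y = fRe (a * (x * fconj y))" by (simp add: inner_eq_fRe mult.assoc)
  also have "\<dots> = inner a (fconj (x * fconj y))" by (simp add: inner_eq_fRe fconj_fconj)
  also have "\<dots> = inner (fconj a) (x * fconj y)"
    by (metis inner_fconj_fconj fconj_fconj)
  also have "\<dots> = inner (x * fconj y) (fconj a)" by (rule inner_commute)
  also have "\<dots> = inner x (fconj a * y)"
    by (simp add: inner_eq_fRe fconj_mult fconj_fconj mult.assoc)
  finally show ?thesis .
qed

lemma fconj_eq_self_imp_of_real:
  assumes "fconj x = (x::'a::scalar_algebra)"
  shows "x = of_real (fRe x)"
  using fRe_scaleR_1[of x] assms by (simp add: of_real_def scaleR_2[symmetric])


section \<open>Matrices over the scalars\<close>

text \<open>
  The Frobenius metric is the Euclidean inner product of the ambient space, so that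
  Euclidean geometry applies to it.
\<close>

lemma frobenius_eq_inner: "frobenius A B = inner A B"
proof -
  have "frobenius A B = (\<Sum>i\<in>UNIV. \<Sum>j\<in>UNIV. fRe (A $ i $ j * fconj (B $ i $ j)))"
    unfolding frobenius_def trace_def matrix_matrix_mult_def conj_transpose_def
    by (simp add: linear_sum[OF linear_fRe])
  then show ?thesis by (simp add: inner_vec_def inner_eq_fRe)
qed

lemma conj_transpose_mult:
  fixes A B :: "'a::scalar_algebra^'n^'n"
  shows "conj_transpose (A ** B) = conj_transpose B ** conj_transpose A"
  by (simp add: conj_transpose_def matrix_matrix_mult_def vec_eq_iff fconj_sum fconj_mult)

lemma conj_transpose_conj_transpose [simp]: "conj_transpose (conj_transpose A) = A"
  by (simp add: conj_transpose_def vec_eq_iff fconj_fconj)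

lemma conj_transpose_diag [simp]:
  "conj_transpose (diag l :: 'a::scalar_algebra^'n^'n) = diag l"
  by (simp add: conj_transpose_def diag_def vec_eq_iff)

lemma subspace_hermitian: "subspace (hermitian_matrices :: ('a::scalar_algebra^'n^'n) set)"
  by (auto simp: subspace_def hermitian_matrices_def conj_transpose_def vec_eq_iff fconj_add)

lemma inner_matrix_mult_left:
  fixes A B C :: "'a::scalar_algebra^'n^'n"
  shows "inner (A ** B) C = inner B (conj_transpose A ** C)"
proof -
  have "inner (A ** B) C = (\<Sum>i\<in>UNIV. \<Sum>k\<in>UNIV. \<Sum>j\<in>UNIV. inner (A$i$j * B$j$k) (C$i$k))"
    by (simp add: inner_vec_def matrix_matrix_mult_def inner_sum_left)
  also have "\<dots> = (\<Sum>i\<in>UNIV. \<Sum>k\<in>UNIV. \<Sum>j\<in>UNIV. inner (B$j$k) (fconj (A$i$j) * C$i$k))"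
    by (simp add: inner_mult_left_fconj)
  also have "\<dots> = (\<Sum>j\<in>UNIV. \<Sum>k\<in>UNIV. \<Sum>i\<in>UNIV. inner (B$j$k) (fconj (A$i$j) * C$i$k))"
    by (subst sum.swap) (subst (2) sum.swap, subst sum.swap, rule refl)
  also have "\<dots> = inner B (conj_transpose A ** C)"
    by (simp add: inner_vec_def matrix_matrix_mult_def conj_transpose_def inner_sum_right)
  finally show ?thesis .
qed

lemma inner_conj_transpose:
  "inner (conj_transpose A) (conj_transpose B) = inner A (B :: 'a::scalar_algebra^'n^'n)"
  unfolding inner_vec_def conj_transpose_def
  by (simp add: inner_fconj_fconj) (rule sum.swap)

lemma inner_matrix_mult_right:
  fixes A B C :: "'a::scalar_algebra^'n^'n"
  shows "inner (B ** A) C = inner B (C ** conj_transpose A)"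
  using inner_matrix_mult_left[of "conj_transpose A" "conj_transpose B" "conj_transpose C"]
  by (metis conj_transpose_conj_transpose conj_transpose_mult inner_conj_transpose)

lemma inner_matrix_vector_mult:
  "inner (A *v x) y = inner x (conj_transpose A *v (y :: 'a::scalar_algebra^'n))"
proof -
  have "inner (A *v x) y = (\<Sum>i\<in>UNIV. \<Sum>j\<in>UNIV. inner (A$i$j * x$j) (y$i))"
    by (simp add: inner_vec_def matrix_vector_mult_def inner_sum_left)
  also have "\<dots> = (\<Sum>j\<in>UNIV. \<Sum>i\<in>UNIV. inner (x$j) (fconj (A$i$j) * y$i))"
    by (subst sum.swap) (simp add: inner_mult_left_fconj)
  also have "\<dots> = inner x (conj_transpose A *v y)"
    by (simp add: inner_vec_def matrix_vector_mult_def conj_transpose_def inner_sum_right)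
  finally show ?thesis .
qed

lemma linear_matrix_vector: "linear (\<lambda>x. A *v (x :: 'a::scalar_algebra^'n))"
  by (auto intro!: linearI
      simp: matrix_vector_mult_def vec_eq_iff distrib_left sum.distrib scaleR_sum_right)

lemma bounded_bilinear_matrix_mult:
  "bounded_bilinear ((**) :: 'a::scalar_algebra^'n^'n \<Rightarrow> 'a^'n^'n \<Rightarrow> 'a^'n^'n)"
  unfolding bilinear_conv_bounded_bilinear[symmetric] bilinear_def
  by (auto intro!: linearI simp: matrix_matrix_mult_def vec_eq_iff distrib_left distrib_right
      sum.distrib scaleR_sum_right)

lemma bounded_bilinear_matrix_vector_mult:
  "bounded_bilinear ((*v) :: 'a::scalar_algebra^'n^'n \<Rightarrow> 'a^'n \<Rightarrow> 'a^'n)"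
  unfolding bilinear_conv_bounded_bilinear[symmetric] bilinear_def
  by (auto intro!: linearI simp: matrix_vector_mult_def vec_eq_iff distrib_left distrib_right
      sum.distrib scaleR_sum_right)

text \<open>
  Over a division ring, a one-sided inverse of a square matrix is two-sided because the matrix acts
  on a real vector space of finite dimension, where surjective linear maps are injective.
\<close>

lemma matrix_right_inverse_imp_left:
  fixes A B :: "'a::scalar_algebra^'n^'n"
  assumes "A ** B = mat 1"
  shows "B ** A = mat 1"
proof -
  have AB: "A *v (B *v x) = x" for x
    by (simp add: matrix_vector_mul_assoc assms)
  have "surj (\<lambda>x. A *v x)" by (metis AB surjI)
  then have inj: "inj (\<lambda>x. A *v x)"
    using linear_surj_imp_inj[OF linear_matrix_vector] by blast
  have "B *v (A *v x) = x" for x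
    using injD[OF inj] AB by blast
  then show ?thesis by (simp add: matrix_eq matrix_vector_mul_assoc)
qed

lemma unitary_group_iff:
  "U \<in> unitary_group \<longleftrightarrow> U ** conj_transpose U = mat 1 \<and> conj_transpose U ** U = mat 1"
  unfolding unitary_group_def using matrix_right_inverse_imp_left by auto

lemma unitary_conj_transpose: "U \<in> unitary_group \<Longrightarrow> conj_transpose U \<in> unitary_group"
  by (simp add: unitary_group_iff)

lemma unitary_mult: "U \<in> unitary_group \<Longrightarrow> V \<in> unitary_group \<Longrightarrow> U ** V \<in> unitary_group"
  unfolding unitary_group_def
  by (simp add: conj_transpose_mult) (metis matrix_mul_assoc matrix_mul_rid)

lemma unitary_mat_1: "mat 1 \<in> unitary_group"
proof -
  have "conj_transpose (mat 1 :: 'a^'n^'n) = mat 1"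
    by (simp add: conj_transpose_def mat_def vec_eq_iff if_distrib[of fconj] eq_commute)
  then show ?thesis by (simp add: unitary_group_def)
qed

section \<open>Diagonalization of hermitian matrices with simple spectrum\<close>

lemma diag_mult: "(diag l ** M) $ i $ j = l $ i *\<^sub>R (M :: 'a::scalar_algebra^'n^'n) $ i $ j"
  by (simp add: matrix_matrix_mult_def diag_def if_distrib[of "\<lambda>x. x * _"] of_real_def
      cong: if_cong)

lemma mult_diag: "((M :: 'a::scalar_algebra^'n^'n) ** diag l) $ i $ j = l $ j *\<^sub>R M $ i $ j"
  by (simp add: matrix_matrix_mult_def diag_def if_distrib[of "\<lambda>x. _ * x"] of_real_def
      cong: if_cong)

lemma diag_mult_diag:
  "diag l ** diag m = (diag (\<chi> i. l $ i * m $ i) :: 'a::scalar_algebra^'n^'n)"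
  by (simp add: vec_eq_iff diag_mult) (simp add: diag_def of_real_def)

lemma bounded_linear_diag: "bounded_linear (diag :: real^'n \<Rightarrow> 'a::scalar_algebra^'n^'n)"
  unfolding linear_conv_bounded_linear[symmetric]
  by (auto intro!: linearI simp: diag_def vec_eq_iff of_real_def scaleR_add_left)

lemma inner_diag_diag:
  "inner (diag l) (diag m :: 'a::scalar_algebra^'n^'n) = inner l m"
proof -
  have "inner (diag l) (diag m :: 'a^'n^'n)
      = (\<Sum>i\<in>UNIV. \<Sum>j\<in>UNIV. if i = j then l $ i * m $ i else 0)"
    unfolding inner_vec_def
    by (intro sum.cong refl) (simp add: diag_def of_real_def power2_norm_eq_inner[symmetric]
        flip: norm_eq_sqrt_inner)
  then show ?thesis by (simp add: inner_vec_def)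
qed

lemma inner_unitary_conjugation:
  assumes "U \<in> unitary_group"
  shows "inner (U ** A ** conj_transpose U) (U ** B ** conj_transpose U)
    = inner A (B :: 'a::scalar_algebra^'n^'n)"
proof -
  have "inner (U ** A ** conj_transpose U) (U ** B ** conj_transpose U)
    = inner (U ** A) (U ** B ** conj_transpose U ** U)"
    by (simp add: inner_matrix_mult_right)
  also have "\<dots> = inner (U ** A) (U ** B)"
    using assms by (simp add: matrix_mul_assoc[symmetric] unitary_group_iff)
  also have "\<dots> = inner A B"
    using assms by (simp add: inner_matrix_mult_left matrix_mul_assoc unitary_group_iff)
  finally show ?thesis .
qed

lemma unitary_conjugation_mult:
  assumes "U \<in> unitary_group"
  shows "(U ** A ** conj_transpose U) ** (U ** B ** conj_transpose U)
    = U ** (A ** B) ** conj_transpose (U :: 'a::scalar_algebra^'n^'n)"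
proof -
  have "(U ** A ** conj_transpose U) ** (U ** B ** conj_transpose U)
    = U ** A ** (conj_transpose U ** U) ** B ** conj_transpose U"
    by (simp only: matrix_mul_assoc)
  also have "conj_transpose U ** U = mat 1" using assms by (simp add: unitary_group_iff)
  finally show ?thesis by (simp add: matrix_mul_assoc)
qed

lemma hermitian_unitary_conjugation:
  "U ** diag l ** conj_transpose U \<in> (hermitian_matrices :: ('a::scalar_algebra^'n^'n) set)"
  by (simp add: hermitian_matrices_def conj_transpose_mult matrix_mul_assoc)

lemma matrix_vector_mult_right_scalar:
  "A *v (\<chi> k. v $ k * x) = (\<chi> k. (A *v v) $ k * (x :: 'a::scalar_algebra))"
  by (simp add: matrix_vector_mult_def vec_eq_iff sum_distrib_right mult.assoc)

text \<open>
  After the change of basis, a nonzero entry \<open>w\<close> of an eigenvector satisfies \<open>l\<^sub>k w = w x\<close>. As \<open>l\<^sub>k\<close> is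
  real and hence central, \<open>w\<close> cancels, so the conjugates by which right eigenvalues may differ in
  general do not occur.
\<close>

lemma eigenvalues_unitary_conjugation_diag:
  fixes U :: "'a::scalar_algebra^'n^'n"
  assumes U: "U \<in> unitary_group"
  shows "eigenvalues (U ** diag l ** conj_transpose U) = of_real ` range (($) l)"
proof (intro equalityI subsetI)
  have UU: "conj_transpose U *v (U *v v) = v" "U *v (conj_transpose U *v v) = v" for v
    using U by (simp_all add: matrix_vector_mul_assoc unitary_group_iff)
  have D: "(diag l *v w) $ k = l $ k *\<^sub>R w $ k" for w :: "'a^'n" and k
    by (simp add: matrix_vector_mult_def diag_def if_distrib[of "\<lambda>x. x * _"] of_real_def
        cong: if_cong)
  fix x :: 'a
  {
    assume "x \<in> eigenvalues (U ** diag l ** conj_transpose U)"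
    then obtain v where "v \<noteq> 0"
      and "U ** diag l ** conj_transpose U *v v = (\<chi> k. v $ k * x)"
      by (auto simp: eigenvalues_def)
    then have v: "U *v (diag l *v (conj_transpose U *v v)) = (\<chi> k. v $ k * x)"
      by (simp add: matrix_vector_mul_assoc matrix_mul_assoc)
    define w where "w = conj_transpose U *v v"
    have "w \<noteq> 0" using UU(2)[of v] \<open>v \<noteq> 0\<close> unfolding w_def by fastforce
    then obtain k where k: "w $ k \<noteq> 0" by (auto simp: vec_eq_iff)
    have "diag l *v w = (\<chi> k. w $ k * x)"
      using arg_cong[OF v, of "(*v) (conj_transpose U)"]
      by (simp add: UU w_def matrix_vector_mult_right_scalar)
    then have "l $ k *\<^sub>R w $ k = w $ k * x" using D[of w k] by simp
    then have "w $ k * (x - of_real (l $ k)) = 0"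
      by (simp add: right_diff_distrib of_real_def)
    then show "x \<in> of_real ` range (($) l)" using k by auto
  next
    assume "x \<in> of_real ` range (($) l)"
    then obtain i where x: "x = of_real (l $ i)" by auto
    define w :: "'a^'n" where "w = axis i 1"
    have "diag l *v w = (\<chi> k. w $ k * x)"
      by (simp add: vec_eq_iff D) (simp add: w_def axis_def x of_real_def)
    then have "U ** diag l ** conj_transpose U *v (U *v w) = (\<chi> k. (U *v w) $ k * x)"
      by (simp add: matrix_vector_mul_assoc[symmetric] UU matrix_vector_mult_right_scalar)
    moreover have "U *v w \<noteq> 0"
    proof
      assume "U *v w = 0"
      then have "w = 0" using UU(1)[of w] by simp
      then have "w $ i = 0" by simp
      then show False by (simp add: w_def axis_def)
    qed
    ultimately show "x \<in> eigenvalues (U ** diag l ** conj_transpose U)"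
      unfolding eigenvalues_def by blast
  }
qed

text \<open>
  The scalar \<open>v\<^sup>* A v\<close> equals \<open>\<bar>v\<bar>\<^sup>2 x\<close> and is its own conjugate.
\<close>

lemma eigenvalue_hermitian_real:
  fixes A :: "'a::scalar_algebra^'n^'n"
  assumes A: "A \<in> hermitian_matrices" and x: "x \<in> eigenvalues A"
  shows "x \<in> range of_real"
proof -
  obtain v where v: "v \<noteq> 0" "A *v v = (\<chi> k. v $ k * x)"
    using x by (auto simp: eigenvalues_def)
  have Aij: "fconj (A $ i $ j) = A $ j $ i" for i j
    using A by (auto simp: hermitian_matrices_def conj_transpose_def vec_eq_iff)
  have n: "(\<Sum>k\<in>UNIV. (norm (v $ k))\<^sup>2) \<noteq> 0"
    using v(1) by (auto simp: sum_nonneg_eq_0_iff vec_eq_iff)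
  define h where "h = (\<Sum>k\<in>UNIV. fconj (v $ k) * (A *v v) $ k)"
  have "h = (\<Sum>k\<in>UNIV. (norm (v $ k))\<^sup>2) *\<^sub>R x"
    by (simp add: h_def v(2) mult.assoc[symmetric] fconj_mult_self scaleR_sum_left)
  moreover have "fconj h = h"
  proof -
    have h: "h = (\<Sum>k\<in>UNIV. \<Sum>j\<in>UNIV. fconj (v $ k) * A $ k $ j * v $ j)"
      by (simp add: h_def matrix_vector_mult_def sum_distrib_left mult.assoc)
    have "fconj h = (\<Sum>j\<in>UNIV. \<Sum>k\<in>UNIV. fconj (v $ k) * A $ k $ j * v $ j)"
      unfolding h
      by (simp add: fconj_sum fconj_mult Aij fconj_fconj mult.assoc)
    also have "\<dots> = h" unfolding h by (rule sum.swap)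
    finally show ?thesis .
  qed
  ultimately have "fconj x = x" using n by simp
  then show ?thesis using fconj_eq_self_imp_of_real by (metis rangeI)
qed

text \<open>
  Real eigenvalues are those of the matrix as an endomorphism of the underlying real vector space,
  whatever side the scalar stands on; this gives access to Euclidean geometry.
\<close>

lemma real_eigenvalue_iff:
  "of_real r \<in> eigenvalues A \<longleftrightarrow> (\<exists>w. norm w = 1 \<and> A *v w = r *\<^sub>R (w :: 'a::scalar_algebra^'n))"
proof
  assume "of_real r \<in> eigenvalues A"
  then obtain v where v: "v \<noteq> 0" "A *v v = (\<chi> i. v $ i * of_real r)"
    by (auto simp: eigenvalues_def)
  have "A *v v = r *\<^sub>R v" by (simp add: v(2) vec_eq_iff of_real_def)
  then have "A *v (v /\<^sub>R norm v) = r *\<^sub>R (v /\<^sub>R norm v)"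
    by (simp add: linear_scale[OF linear_matrix_vector])
  then show "\<exists>w. norm w = 1 \<and> A *v w = r *\<^sub>R w"
    using v(1) by (intro exI[of _ "v /\<^sub>R norm v"]) simp
next
  assume "\<exists>w. norm w = 1 \<and> A *v w = r *\<^sub>R w"
  then obtain w where "norm w = 1" "A *v w = r *\<^sub>R w" by blast
  moreover from this(1) have "w \<noteq> 0" by auto
  ultimately show "of_real r \<in> eigenvalues A"
    unfolding eigenvalues_def
    by (intro CollectI exI[of _ w]) (simp add: vec_eq_iff of_real_def)
qed

text \<open>
  The columns of \<open>U\<close> are unit eigenvectors \<open>w i\<close>. Evaluating \<open>U\<^sup>* A U\<close> from both sides shows that
  their Gram matrix \<open>G\<close> commutes with \<open>diag l\<close>; as the \<open>l\<^sub>i\<close> are distinct, \<open>G\<close> is diagonal.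
\<close>

lemma hermitian_diagonalization:
  fixes A :: "'a::scalar_algebra^'n^'n"
  assumes A: "A \<in> hermitian_matrices" and inj: "inj (($) l)"
    and ev: "\<And>i. of_real (l $ i) \<in> eigenvalues A"
  shows "\<exists>U\<in>unitary_group. A = U ** diag l ** conj_transpose U"
proof -
  have "\<exists>w. norm w = 1 \<and> A *v w = l $ i *\<^sub>R w" for i
    using ev[of i] by (simp add: real_eigenvalue_iff)
  then obtain w where w: "\<And>i. norm (w i) = 1" "\<And>i. A *v w i = l $ i *\<^sub>R w i" by metis
  define U :: "'a^'n^'n" where "U = (\<chi> r i. w i $ r)"
  define G where "G = conj_transpose U ** U"
  have AU: "A ** U = U ** diag l"
  proof (simp add: vec_eq_iff mult_diag, intro allI)
    fix r i
    show "(A ** U) $ r $ i = l $ i *\<^sub>R U $ r $ i"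
      using arg_cong[OF w(2)[of i], of "\<lambda>v. v $ r"]
      by (simp add: matrix_matrix_mult_def matrix_vector_mult_def U_def)
  qed
  have "diag l ** G = conj_transpose (A ** U) ** U"
    by (simp add: AU conj_transpose_mult G_def matrix_mul_assoc)
  also have "\<dots> = conj_transpose U ** (A ** U)"
    using A by (simp add: conj_transpose_mult hermitian_matrices_def matrix_mul_assoc)
  also have "\<dots> = G ** diag l"
    by (simp add: AU G_def matrix_mul_assoc)
  finally have "l $ i *\<^sub>R G $ i $ j = l $ j *\<^sub>R G $ i $ j" for i j
    by (metis diag_mult mult_diag)
  then have off: "G $ i $ j = 0" if "i \<noteq> j" for i j
    using that inj by (metis injD scaleR_cancel_right)
  have diag1: "G $ i $ i = 1" for i
  proof -
    have "G $ i $ i = (\<Sum>r\<in>UNIV. (norm (w i $ r))\<^sup>2) *\<^sub>R 1"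
      by (simp add: G_def U_def conj_transpose_def matrix_matrix_mult_def fconj_mult_self
          scaleR_sum_left)
    also have "(\<Sum>r\<in>UNIV. (norm (w i $ r))\<^sup>2) = (norm (w i))\<^sup>2"
      by (simp add: norm_vec_def L2_set_def sum_nonneg)
    finally show ?thesis by (simp add: w)
  qed
  have "G = mat 1" by (simp add: vec_eq_iff mat_def off diag1)
  then have U: "U \<in> unitary_group"
    unfolding unitary_group_iff G_def using matrix_right_inverse_imp_left by blast
  have "A = A ** (U ** conj_transpose U)" using U by (simp add: unitary_group_iff)
  also have "\<dots> = U ** diag l ** conj_transpose U" by (simp add: matrix_mul_assoc AU)
  finally show ?thesis using U by blast
qed

lemma strict_mono_finite_linorder_id:
  fixes f :: "'n::{finite,linorder} \<Rightarrow> 'n"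
  assumes f: "strict_mono f"
  shows "f i = i"
proof -
  have "\<not> f j < j" for j
  proof
    assume "f j < j"
    define m where "m = Min {j. f j < j}"
    have "m \<in> {j. f j < j}" unfolding m_def using \<open>f j < j\<close> by (intro Min_in) auto
    then have "f m < m" "f (f m) < f m" using f by (auto simp: strict_mono_def)
    moreover have "m \<le> f m" unfolding m_def using \<open>f (f m) < f m\<close>
      by (intro Min_le) (auto simp: m_def)
    ultimately show False by simp
  qed
  moreover have "\<not> j < f j" for j
  proof
    assume "j < f j"
    define m where "m = Max {j. j < f j}"
    have "m \<in> {j. j < f j}" unfolding m_def using \<open>j < f j\<close> by (intro Max_in) auto
    then have "m < f m" "f m < f (f m)" using f by (auto simp: strict_mono_def)
    moreover have "f m \<le> m" unfolding m_def using \<open>f m < f (f m)\<close>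
      by (intro Max_ge) (auto simp: m_def)
    ultimately show False by simp
  qed
  ultimately show ?thesis by (meson not_less_iff_gr_or_eq)
qed

lemma weyl_chamber_less_iff:
  assumes "l \<in> weyl_chamber"
  shows "l $ i < l $ j \<longleftrightarrow> j < (i :: 'n::{finite,linorder})"
  using assms unfolding weyl_chamber_def mem_Collect_eq
  by (metis less_asym not_less_iff_gr_or_eq)

lemma weyl_chamber_inj: "l \<in> weyl_chamber \<Longrightarrow> inj (($) l)"
  by (metis injI less_irrefl not_less_iff_gr_or_eq weyl_chamber_less_iff)

text \<open>
  If every entry of \<open>l\<close> occurs in \<open>m\<close>, the resulting reindexing is strictly monotone, and only the
  identity is a strictly monotone map of a finite linear order into itself.
\<close>

lemma weyl_chamber_eqI:
  fixes l m :: "real^'n::{finite,linorder}"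
  assumes l: "l \<in> weyl_chamber" and m: "m \<in> weyl_chamber"
    and lm: "range (($) l) \<subseteq> range (($) m)"
  shows "l = m"
proof -
  have "\<forall>i. \<exists>k. l $ i = m $ k" using lm by blast
  then obtain k where k: "\<And>i. l $ i = m $ k i" by metis
  have "strict_mono k"
    unfolding strict_mono_def
    using weyl_chamber_less_iff[OF l] weyl_chamber_less_iff[OF m] k by simp
  then have "k i = i" for i by (rule strict_mono_finite_linorder_id)
  then show ?thesis using k by (simp add: vec_eq_iff)
qed

lemma weyl_chamber_enumeration:
  assumes "finite E" and "card E = CARD('n::{finite,linorder})"
  obtains l where "l \<in> weyl_chamber" and "range (($) (l :: real^'n::{finite,linorder})) = E"
proof -
  define xs where "xs = rev (sorted_list_of_set E)"
  have xs: "sorted_wrt (>) xs" "length xs = CARD('n)" "set xs = E"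
    using assms by (simp_all add: xs_def sorted_wrt_rev)
  have lt: "card {..<i} < card {..<j}" if "i < j" for i j :: 'n
    using that by (intro psubset_card_mono) auto
  have n: "card {..<i} < length xs" for i :: 'n
    unfolding xs(2) by (intro psubset_card_mono) auto
  define l :: "(real, 'n) vec" where "l = (\<chi> i. xs ! card {..<i})"
  have l: "l \<in> weyl_chamber"
    using sorted_wrt_nth_less[OF xs(1)] lt n by (simp add: weyl_chamber_def l_def)
  have "range (($) l) \<subseteq> E"
    using n nth_mem unfolding xs(3)[symmetric] by (auto simp: l_def)
  moreover have "card (range (($) l)) = card E"
    using weyl_chamber_inj[OF l] assms(2) by (simp add: card_image)
  ultimately have "range (($) l) = E"
    using assms(1) card_subset_eq by blast
  with l show ?thesis by (rule that)
qed

definition ordered_eigenvalues ::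
  "('a::scalar_algebra, 'n::{finite,linorder}) square_matrix \<Rightarrow> (real, 'n) vec" where
  "ordered_eigenvalues A = (THE l. l \<in> weyl_chamber \<and> eigenvalues A = of_real ` range (($) l))"

lemma ordered_eigenvaluesI:
  fixes A :: "('a::scalar_algebra, 'n::{finite,linorder}) square_matrix"
  assumes "l \<in> weyl_chamber" and "eigenvalues A = of_real ` range (($) l)"
  shows "ordered_eigenvalues A = l"
  unfolding ordered_eigenvalues_def
proof (rule the_equality)
  fix m :: "(real, 'n) vec" assume m: "m \<in> weyl_chamber \<and> eigenvalues A = of_real ` range (($) m)"
  have "of_real ` range (($) m) = (of_real ` range (($) l) :: 'a set)" using m assms(2) by simp
  then have "range (($) m) = range (($) l)"
    by (subst (asm) inj_image_eq_iff) (auto intro: injI)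
  then show "m = l" using weyl_chamber_eqI[of m l] m assms(1) by simp
qed (use assms in simp)

lemma unitary_conjugation_diag_simple:
  fixes U :: "('a::scalar_algebra, 'n::{finite,linorder}) square_matrix"
  assumes U: "U \<in> unitary_group" and l: "l \<in> weyl_chamber"
  shows "U ** diag l ** conj_transpose U \<in> simple_hermitian"
    and "ordered_eigenvalues (U ** diag l ** conj_transpose U) = l"
proof -
  have e: "eigenvalues (U ** diag l ** conj_transpose U) = of_real ` range (($) l)"
    by (rule eigenvalues_unitary_conjugation_diag[OF U])
  have "inj (of_real :: real \<Rightarrow> 'a)" by (auto intro: injI)
  then have "inj (\<lambda>i. of_real (l $ i) :: 'a)"
    using inj_compose[OF _ weyl_chamber_inj[OF l], of of_real] by (simp add: o_def)
  then have "card (eigenvalues (U ** diag l ** conj_transpose U)) = CARD('n)"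
    unfolding e image_image by (rule card_image)
  then show "U ** diag l ** conj_transpose U \<in> simple_hermitian"
    using hermitian_unitary_conjugation by (simp add: simple_hermitian_def)
  show "ordered_eigenvalues (U ** diag l ** conj_transpose U) = l"
    using l e by (rule ordered_eigenvaluesI)
qed

lemma diag_simple:
  assumes "l \<in> weyl_chamber"
  shows "diag l \<in> (simple_hermitian :: (('a::scalar_algebra, 'n::{finite,linorder}) square_matrix) set)"
    and "ordered_eigenvalues (diag l :: ('a::scalar_algebra, 'n::{finite,linorder}) square_matrix) = l"
proof -
  have c: "conj_transpose (mat 1) = (mat 1 :: ('a, 'n) square_matrix)"
    using unitary_mat_1 by (simp add: unitary_group_def)
  show "diag l \<in> (simple_hermitian :: (('a, 'n) square_matrix) set)"
    "ordered_eigenvalues (diag l :: ('a::scalar_algebra, 'n::{finite,linorder}) square_matrix) = l"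
    using unitary_conjugation_diag_simple[OF unitary_mat_1 assms, where 'a='a] by (simp_all add: c)
qed

text \<open>
  Diagonalization leaves no room for eigenvalues other than the \<open>n\<close> distinct ones exhibited, so these
  are the whole spectrum.
\<close>

lemma simpleI:
  fixes A :: "('a::scalar_algebra, 'n::{finite,linorder}) square_matrix"
  assumes "A \<in> hermitian_matrices" and l: "l \<in> weyl_chamber"
    and "\<And>i. of_real (l $ i) \<in> eigenvalues A"
  shows "A \<in> simple_hermitian" and "ordered_eigenvalues A = l"
  using hermitian_diagonalization[OF assms(1) weyl_chamber_inj[OF l] assms(3)]
    unitary_conjugation_diag_simple[OF _ l] by auto

lemma simple_diagonalization:
  fixes A :: "('a::scalar_algebra, 'n::{finite,linorder}) square_matrix"
  assumes A: "A \<in> simple_hermitian"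
  obtains U where "U \<in> unitary_group" "ordered_eigenvalues A \<in> weyl_chamber"
    "A = U ** diag (ordered_eigenvalues A) ** conj_transpose U"
proof -
  define E where "E = {r. (of_real r :: 'a) \<in> eigenvalues A}"
  have h: "A \<in> hermitian_matrices" and c: "card (eigenvalues A) = CARD('n)"
    using A by (auto simp: simple_hermitian_def)
  have E: "eigenvalues A = of_real ` E"
    using eigenvalue_hermitian_real[OF h] by (auto simp: E_def)
  have inj: "inj_on (of_real :: real \<Rightarrow> 'a) E" by (auto intro: inj_onI)
  have "card E = CARD('n)" using c unfolding E card_image[OF inj] .
  moreover from this have "finite E" by (metis card.infinite card_0_eq finite UNIV_not_empty)
  ultimately obtain l :: "(real, 'n) vec" where l: "l \<in> weyl_chamber" "range (($) l) = E"
    by (metis weyl_chamber_enumeration)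
  have "of_real (l $ i) \<in> eigenvalues A" for i using l(2) by (auto simp: E_def)
  from simpleI(2)[OF h l(1) this] hermitian_diagonalization[OF h weyl_chamber_inj[OF l(1)] this]
  show ?thesis using that l(1) by auto
qed

lemma unitary_orbit_conjugation:
  fixes U A :: "('a::scalar_algebra, 'n::finite) square_matrix"
  assumes U: "U \<in> unitary_group"
  shows "unitary_orbit (U ** A ** conj_transpose U) = unitary_orbit A"
proof -
  have *: "unitary_orbit (U ** A ** conj_transpose U) \<subseteq> unitary_orbit A"
    if "U \<in> unitary_group" for U A :: "('a, 'n) square_matrix"
    unfolding unitary_orbit_def
  proof clarify
    fix V :: "('a, 'n) square_matrix" assume "V \<in> unitary_group"
    then have "V ** U \<in> unitary_group"
      "V ** (U ** A ** conj_transpose U) ** conj_transpose V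
        = (V ** U) ** A ** conj_transpose (V ** U)"
      using that by (simp_all add: unitary_mult conj_transpose_mult matrix_mul_assoc)
    then show "\<exists>W. V ** (U ** A ** conj_transpose U) ** conj_transpose V
        = W ** A ** conj_transpose W \<and> W \<in> unitary_group" by blast
  qed
  have "A = (conj_transpose U ** U) ** A ** (conj_transpose U ** U)"
    using U by (simp add: unitary_group_iff)
  also have "\<dots> = conj_transpose U ** (U ** A ** conj_transpose U)
      ** conj_transpose (conj_transpose U)"
    by (simp add: matrix_mul_assoc)
  finally show ?thesis
    using *[OF U, of A] *[OF unitary_conj_transpose[OF U], of "U ** A ** conj_transpose U"] by auto
qed

lemma unitary_orbit_ordered_eigenvalues:
  assumes "A \<in> simple_hermitian"
  shows "unitary_orbit (diag (ordered_eigenvalues A)) = unitary_orbit A"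
  using simple_diagonalization[OF assms] unitary_orbit_conjugation by metis

lemma ordered_eigenvalues_weyl:
  "A \<in> simple_hermitian \<Longrightarrow> ordered_eigenvalues A \<in> weyl_chamber"
  using simple_diagonalization by metis

lemma unitary_orbit_eq_imp:
  fixes l m :: "(real, 'n::{finite,linorder}) vec"
  assumes "l \<in> weyl_chamber" "m \<in> weyl_chamber"
    and eq: "unitary_orbit (diag l) = unitary_orbit (diag m :: ('a::scalar_algebra, 'n) square_matrix)"
  shows "l = m"
proof -
  have "mat 1 ** diag l ** conj_transpose (mat 1) \<in> unitary_orbit (diag l :: ('a, 'n) square_matrix)"
    unfolding unitary_orbit_def using unitary_mat_1 by blast
  moreover have "mat 1 ** diag l ** conj_transpose (mat 1) = (diag l :: ('a, 'n) square_matrix)"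
    using unitary_mat_1[where 'a='a and 'b='n] by (simp add: unitary_group_def)
  ultimately obtain U :: "('a, 'n) square_matrix" where "U \<in> unitary_group" "diag l = U ** diag m ** conj_transpose U"
    unfolding eq by (auto simp: unitary_orbit_def)
  then show ?thesis
    using unitary_conjugation_diag_simple(2)[OF _ assms(2), of U] diag_simple(2)[OF assms(1), where 'a='a]
    by simp
qed

section \<open>Perturbation of simple eigenvalues\<close>

text \<open>
  Let \<open>M = T - c\<close> and let \<open>u\<close> minimize \<open>\<bar>M x\<bar>\<close> on the unit sphere, with minimum \<open>m\<close>. The quadratic form
  \<open>Q x = \<bar>M x\<bar>\<^sup>2 - m\<^sup>2 \<bar>x\<bar>\<^sup>2\<close> is nonnegative and vanishes at \<open>u\<close>, so its gradient \<open>2 d\<close> vanishes there as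
  well, that is, \<open>M\<^sup>2 u = m\<^sup>2 u\<close>. Factoring \<open>M\<^sup>2 - m\<^sup>2\<close> shows that \<open>c - m\<close> or \<open>c + m\<close> is an eigenvalue
  of \<open>T\<close>.
\<close>

lemma selfadjoint_eigenvalue_near:
  fixes T :: "'b::euclidean_space \<Rightarrow> 'b"
  assumes lin: "linear T" and adj: "\<And>x y. inner (T x) y = inner x (T y)" and v: "norm v = 1"
  obtains \<mu> w where "norm w = 1" "T w = \<mu> *\<^sub>R w" "\<bar>\<mu> - c\<bar> \<le> norm (T v - c *\<^sub>R v)"
proof -
  define M where "M = (\<lambda>x. T x - c *\<^sub>R x)"
  have linM: "linear M"
    unfolding M_def using lin by (intro linear_compose_sub) auto
  have adjM: "inner (M x) y = inner x (M y)" for x y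
    by (simp add: M_def inner_diff_left inner_diff_right adj)
  have "continuous_on (sphere 0 1) (\<lambda>x. norm (M x))"
    by (intro continuous_on_norm linear_continuous_on) (simp add: linM flip: linear_conv_bounded_linear)
  moreover have "sphere (0::'b) 1 \<noteq> {}" using v by (auto intro: exI[of _ v])
  ultimately obtain u where u: "norm u = 1" "\<And>x. norm x = 1 \<Longrightarrow> norm (M u) \<le> norm (M x)"
    using continuous_attains_inf[OF compact_sphere, of 0 1 "\<lambda>x. norm (M x)"] by auto
  define m where "m = norm (M u)"
  have m0: "m \<ge> 0" by (simp add: m_def)
  define Q where "Q = (\<lambda>x. inner (M x) (M x) - m\<^sup>2 * inner x x)"
  have Q0: "Q x \<ge> 0" for x
  proof (cases "x = 0")
    case False
    then have "m \<le> norm (M (x /\<^sub>R norm x))" unfolding m_def by (intro u) simp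
    also have "\<dots> = norm (M x) / norm x"
      by (simp add: linear_scale[OF linM] divide_inverse mult.commute)
    finally have "m * norm x \<le> norm (M x)" using False by (simp add: field_simps)
    then have "(m * norm x)\<^sup>2 \<le> (norm (M x))\<^sup>2" using m0 by (intro power_mono) auto
    then show ?thesis by (simp add: Q_def power2_norm_eq_inner power_mult_distrib)
  qed (simp add: Q_def linear_0[OF linM])
  have Qu: "Q u = 0" using u(1) by (simp add: Q_def m_def power2_norm_eq_inner norm_eq_1)
  define d where "d = M (M u) - m\<^sup>2 *\<^sub>R u"
  have Qud: "Q (u + t *\<^sub>R d) = 2 * t * inner d d + t\<^sup>2 * Q d" for t
  proof -
    have "inner d d = inner (M u) (M d) - m\<^sup>2 * inner u d"
      by (subst (1) d_def) (simp add: inner_diff_left adjM)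
    then have e: "inner (M u) (M d) = inner d d + m\<^sup>2 * inner u d" by simp
    have "Q (u + t *\<^sub>R d) = Q u + 2 * t * inner d d + t\<^sup>2 * Q d"
      by (simp add: Q_def linear_add[OF linM] linear_scale[OF linM] inner_add_left inner_add_right
          inner_commute[of "M d" "M u"] inner_commute[of d u] e algebra_simps power2_eq_square)
    then show ?thesis by (simp add: Qu)
  qed
  have "inner d d = 0"
  proof (rule ccontr)
    assume "inner d d \<noteq> 0"
    then have a: "inner d d > 0" using inner_ge_zero[of d] by linarith
    define q where "q = Q d"
    have q: "q \<ge> 0" using Q0 by (simp add: q_def)
    \<comment> \<open>a small step against the gradient would make \<open>Q\<close> negative\<close>
    define t where "t = inner d d / (q + 1)"
    have t: "inner d d = t * (q + 1)" "t > 0" using a q by (simp_all add: t_def)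
    have "0 \<le> 2 * (- t) * (t * (q + 1)) + (- t)\<^sup>2 * q"
      using Q0[of "u + (- t) *\<^sub>R d"] unfolding Qud q_def[symmetric] t(1) .
    also have "\<dots> = t\<^sup>2 * (- q - 2)" by (simp add: power2_eq_square algebra_simps)
    also have "\<dots> < 0" using q t(2) by (intro mult_pos_neg) auto
    finally show False by simp
  qed
  then have MMu: "M (M u) = m\<^sup>2 *\<^sub>R u" by (simp add: d_def)
  have near: "m \<le> norm (T v - c *\<^sub>R v)" using u(2)[OF v] by (simp add: m_def M_def)
  \<comment> \<open>\<open>(M - m) (M + m) u = 0\<close>\<close>
  define z where "z = M u + m *\<^sub>R u"
  show ?thesis
  proof (cases "z = 0")
    case True
    then have "T u = (c - m) *\<^sub>R u" by (simp add: z_def M_def algebra_simps)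
    then show ?thesis using that[of u "c - m"] u(1) near m0 by simp
  next
    case False
    have "M z = m *\<^sub>R z"
      by (simp add: z_def linear_add[OF linM] linear_scale[OF linM] MMu scaleR_add_right
          power2_eq_square)
    then have "T z = (c + m) *\<^sub>R z" by (simp add: M_def algebra_simps)
    then have "T (z /\<^sub>R norm z) = (c + m) *\<^sub>R (z /\<^sub>R norm z)"
      by (simp add: linear_scale[OF lin])
    moreover have "norm (z /\<^sub>R norm z) = 1" using False by simp
    ultimately show ?thesis using that[of "z /\<^sub>R norm z" "c + m"] near m0 by simp
  qed
qed

lemma hermitian_eigenvalue_near:
  fixes A B :: "'a::scalar_algebra^'n^'n"
  assumes B: "B \<in> hermitian_matrices" and r: "of_real r \<in> eigenvalues A"
    and K: "\<And>(M::'a^'n^'n) v. norm (M *v v) \<le> norm M * norm v * K"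
  shows "\<exists>s. of_real s \<in> eigenvalues B \<and> \<bar>s - r\<bar> \<le> norm (B - A) * K"
proof -
  obtain v where v: "norm v = 1" "A *v v = r *\<^sub>R v" using r real_eigenvalue_iff by blast
  have "inner (B *v x) y = inner x (B *v y)" for x y
    using B by (simp add: inner_matrix_vector_mult hermitian_matrices_def)
  from selfadjoint_eigenvalue_near[OF linear_matrix_vector this v(1), of r]
  obtain s w where s: "norm w = 1" "B *v w = s *\<^sub>R w" "\<bar>s - r\<bar> \<le> norm (B *v v - r *\<^sub>R v)"
    by metis
  have "B *v v - r *\<^sub>R v = (B - A) *v v"
    by (simp add: v(2)[symmetric] matrix_vector_mult_def vec_eq_iff left_diff_distrib sum_subtractf)
  then have "\<bar>s - r\<bar> \<le> norm (B - A) * K"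
    using s(3) K[of "B - A" v] v(1) by simp
  moreover have "of_real s \<in> eigenvalues B"
    unfolding real_eigenvalue_iff using s(1,2) by blast
  ultimately show ?thesis by blast
qed

text \<open>
  Within half the smallest gap \<open>g\<close> between eigenvalues of \<open>A\<close>, the eigenvalues of a nearby \<open>B\<close> found
  by \<open>hermitian_eigenvalue_near\<close> are distinct and in the same order as those of \<open>A\<close>, so they are the
  whole spectrum of \<open>B\<close>.
\<close>

lemma simple_hermitian_perturbation:
  fixes A :: "('a::scalar_algebra, 'n::{finite,linorder}) square_matrix"
  assumes A: "A \<in> simple_hermitian" and e: "e > 0"
  obtains d where "d > 0"
    and "\<And>B. B \<in> hermitian_matrices \<Longrightarrow> norm (B - A) < d \<Longrightarrow> B \<in> simple_hermitian \<and>
      (\<forall>i. \<bar>ordered_eigenvalues B $ i - ordered_eigenvalues A $ i\<bar> < e)"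
proof -
  define l where "l = ordered_eigenvalues A"
  have l: "l \<in> weyl_chamber" using ordered_eigenvalues_weyl[OF A] by (simp add: l_def)
  have ev: "of_real (l $ i) \<in> eigenvalues A" for i
    using simple_diagonalization[OF A] eigenvalues_unitary_conjugation_diag
    unfolding l_def by (metis image_eqI rangeI)
  obtain K where K: "K > 0" "\<And>(M::('a, 'n) square_matrix) v. norm (M *v v) \<le> norm M * norm v * K"
    using bounded_bilinear.pos_bounded[OF bounded_bilinear_matrix_vector_mult] by blast
  \<comment> \<open>inserting \<open>2 * e\<close> keeps \<open>G\<close> nonempty for \<open>n = 1\<close> and bounds the error \<open>g / 2\<close> by \<open>e\<close>\<close>
  define G where "G = insert (2 * e) ((\<lambda>(i, j). l $ i - l $ j) ` {(i, j). i < j})"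
  define g where "g = Min G"
  have fin: "finite G" unfolding G_def by simp
  have "g \<in> G" unfolding g_def using fin by (intro Min_in) (auto simp: G_def)
  then have g0: "g > 0" using e l by (auto simp: G_def weyl_chamber_def)
  have ge: "g \<le> 2 * e" unfolding g_def using fin by (intro Min_le) (auto simp: G_def)
  have gap: "g \<le> l $ i - l $ j" if "i < j" for i j
    unfolding g_def using fin that by (intro Min_le) (force simp: G_def)+
  show ?thesis
  proof (rule that)
    show "g / 2 / K > 0" using g0 K by simp
    fix B :: "('a, 'n) square_matrix"
    assume B: "B \<in> hermitian_matrices" and BA: "norm (B - A) < g / 2 / K"
    then have lt: "norm (B - A) * K < g / 2" using K by (simp add: field_simps)
    have "\<exists>s. of_real s \<in> eigenvalues B \<and> \<bar>s - l $ i\<bar> < g / 2" for i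
      using hermitian_eigenvalue_near[OF B ev K(2), of i] lt by fastforce
    then obtain s where s: "\<And>i. of_real (s i) \<in> eigenvalues B" "\<And>i. \<bar>s i - l $ i\<bar> < g / 2"
      by metis
    define m where "m = (\<chi> i. s i)"
    have "m \<in> weyl_chamber"
      unfolding weyl_chamber_def mem_Collect_eq
    proof (intro allI impI)
      fix i j :: 'n assume "i < j"
      show "m $ j < m $ i"
        using gap[OF \<open>i < j\<close>] s(2)[of i] s(2)[of j] unfolding m_def vec_lambda_beta
        by linarith
    qed
    then have "B \<in> simple_hermitian" "ordered_eigenvalues B = m"
      using simpleI[OF B, of m] s(1) by (auto simp: m_def)
    moreover have "\<bar>m $ i - l $ i\<bar> < e" for i
      using s(2)[of i] ge by (simp add: m_def)
    ultimately show "B \<in> simple_hermitian \<and>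
      (\<forall>i. \<bar>ordered_eigenvalues B $ i - ordered_eigenvalues A $ i\<bar> < e)"
      by (simp add: l_def)
  qed
qed

lemma openin_simple_hermitian:
  "openin (top_of_set hermitian_matrices)
     (simple_hermitian :: ('a::scalar_algebra, 'n::{finite,linorder}) square_matrix set)"
  unfolding openin_euclidean_subtopology_iff
proof (intro conjI ballI)
  fix A :: "('a::scalar_algebra, 'n::{finite,linorder}) square_matrix"
  assume "A \<in> simple_hermitian"
  from simple_hermitian_perturbation[OF this zero_less_one]
  show "\<exists>e>0. \<forall>x'\<in>hermitian_matrices. dist x' A < e \<longrightarrow> x' \<in> simple_hermitian"
    by (metis dist_norm)
qed (auto simp: simple_hermitian_def)

lemma continuous_on_ordered_eigenvalues:
  "continuous_on (simple_hermitian :: ('a::scalar_algebra, 'n::{finite,linorder}) square_matrix set)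
     (\<lambda>A. ordered_eigenvalues A $ i)"
  unfolding continuous_on_iff
proof (intro ballI allI impI)
  fix A :: "('a::scalar_algebra, 'n::{finite,linorder}) square_matrix" and e :: real
  assume "A \<in> simple_hermitian" "e > 0"
  from simple_hermitian_perturbation[OF this]
  obtain d where "d > 0" and d: "\<And>B. B \<in> hermitian_matrices \<Longrightarrow> norm (B - A) < d \<Longrightarrow>
      \<bar>ordered_eigenvalues B $ i - ordered_eigenvalues A $ i\<bar> < e"
    by metis
  then show "\<exists>d>0. \<forall>x'\<in>simple_hermitian. dist x' A < d \<longrightarrow>
      dist (ordered_eigenvalues x' $ i) (ordered_eigenvalues A $ i) < e"
    by (intro exI[of _ d]) (auto simp: dist_norm simple_hermitian_def)
qed


section \<open>Smoothness of the ordered eigenvalues\<close>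

text \<open>
  The Lagrange interpolation polynomial of the spectral projection onto the \<open>i\<close>-th eigenspace. In
  this form, the projection is visibly as smooth a function of \<open>A\<close> as the eigenvalues are. The
  factors commute, but matrices do not, so the product is taken along a list.
\<close>

definition spectral_projection ::
  "'n \<Rightarrow> ('a::scalar_algebra, 'n::{finite,linorder}) square_matrix \<Rightarrow> ('a, 'n) square_matrix" where
  "spectral_projection i A =
    foldr (\<lambda>j M. inverse (ordered_eigenvalues A $ i - ordered_eigenvalues A $ j) *\<^sub>R
        ((A - ordered_eigenvalues A $ j *\<^sub>R mat 1) ** M))
      (sorted_list_of_set (UNIV - {i})) (mat 1)"

lemma diag_const: "diag (\<chi> k. c) = (c *\<^sub>R mat 1 :: 'a::scalar_algebra^'n^'n)"
  by (simp add: diag_def mat_def vec_eq_iff of_real_def)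

lemma conjugation_linear:
  fixes U :: "'a::scalar_algebra^'n^'n"
  shows "linear (\<lambda>A. U ** A ** conj_transpose U)"
proof -
  have "bounded_linear (\<lambda>A :: 'a^'n^'n. A ** conj_transpose U)"
    "bounded_linear (\<lambda>A :: 'a^'n^'n. U ** A)"
    by (rule bounded_bilinear.bounded_linear_left[OF bounded_bilinear_matrix_mult]
        bounded_bilinear.bounded_linear_right[OF bounded_bilinear_matrix_mult])+
  then show ?thesis
    using bounded_linear_compose bounded_linear.linear by fastforce
qed

text \<open>
  A polynomial in \<open>U diag(l) U\<^sup>*\<close> is evaluated entrywise on \<open>l\<close>, and the Lagrange polynomial takes the
  value 1 at \<open>l\<^sub>i\<close> and 0 at the other \<open>l\<^sub>k\<close>.
\<close>

lemma spectral_projection_eq: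
  fixes A :: "('a::scalar_algebra, 'n::{finite,linorder}) square_matrix"
  assumes U: "U \<in> unitary_group" and l: "l \<in> weyl_chamber" and A: "A = U ** diag l ** conj_transpose U"
  shows "spectral_projection i A = U ** diag (axis i 1) ** conj_transpose U"
proof -
  define f where "f = (\<lambda>A. U ** A ** conj_transpose U)"
  have linf: "linear f" unfolding f_def by (rule conjugation_linear)
  have lind: "linear (diag :: _ \<Rightarrow> ('a, 'n) square_matrix)"
    using bounded_linear_diag by (rule bounded_linear.linear)
  have f1: "mat 1 = f (diag (\<chi> k. 1))"
    using U by (simp add: f_def diag_const unitary_group_iff)
  have fm: "f X ** f Y = f (X ** Y)" for X Y
    unfolding f_def by (rule unitary_conjugation_mult[OF U])
  have ev: "ordered_eigenvalues A = l"
    unfolding A by (rule unitary_conjugation_diag_simple(2)[OF U l])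
  have shift: "A - c *\<^sub>R mat 1 = f (diag (\<chi> k. l $ k - c))" for c
  proof -
    have "A - c *\<^sub>R mat 1 = f (diag (l - c *\<^sub>R (\<chi> k. 1)))"
      by (simp add: linear_diff[OF linf] linear_diff[OF lind] linear_scale[OF linf]
          linear_scale[OF lind] f1[symmetric]) (simp add: A f_def)
    also have "l - c *\<^sub>R (\<chi> k. 1) = (\<chi> k. l $ k - c)" by (simp add: vec_eq_iff)
    finally show ?thesis .
  qed
  have fold: "foldr (\<lambda>j M. inverse (l $ i - l $ j) *\<^sub>R ((A - l $ j *\<^sub>R mat 1) ** M)) js (mat 1)
      = f (diag (\<chi> k. \<Prod>j\<leftarrow>js. inverse (l $ i - l $ j) * (l $ k - l $ j)))" for js
  proof (induction js)
    case Nil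
    then show ?case by (simp add: f1)
  next
    case (Cons j js)
    then show ?case
      by (simp add: shift fm diag_mult_diag linear_scale[OF linf, symmetric]
          linear_scale[OF lind, symmetric])
        (simp add: scaleR_vec_def mult.assoc)
  qed
  have "(\<Prod>j\<leftarrow>sorted_list_of_set (UNIV - {i}). inverse (l $ i - l $ j) * (l $ k - l $ j))
      = axis i 1 $ k" for k
  proof (cases "k = i")
    case True
    have "l $ i \<noteq> l $ j" if "j \<noteq> i" for j
      using weyl_chamber_inj[OF l] that by (metis injD)
    then have "map (\<lambda>j. inverse (l $ i - l $ j) * (l $ k - l $ j)) (sorted_list_of_set (UNIV - {i}))
      = map (\<lambda>j. 1) (sorted_list_of_set (UNIV - {i}))"
      using True by (intro map_cong) auto
    then show ?thesis using True by (simp add: axis_def map_replicate_const)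
  next
    case False
    then have "k \<in> set (sorted_list_of_set (UNIV - {i}))" by simp
    then have "0 \<in> set (map (\<lambda>j. inverse (l $ i - l $ j) * (l $ k - l $ j))
        (sorted_list_of_set (UNIV - {i})))" by force
    then show ?thesis using False by (simp only: prod_list_zero_iff[symmetric]) (simp add: axis_def)
  qed
  then have "(\<chi> k. \<Prod>j\<leftarrow>sorted_list_of_set (UNIV - {i}). inverse (l $ i - l $ j) * (l $ k - l $ j))
      = axis i 1" by (simp add: vec_eq_iff)
  then show ?thesis unfolding spectral_projection_def ev fold by (simp add: f_def)
qed

lemma
  fixes A :: "('a::scalar_algebra, 'n::{finite,linorder}) square_matrix"
  assumes A: "A \<in> simple_hermitian"
  shows spectral_projection_orthonormal:
      "inner (spectral_projection i A) (spectral_projection j A) = (if i = j then 1 else 0)"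
    and spectral_projection_hermitian: "spectral_projection i A \<in> hermitian_matrices"
    and spectral_projection_idem:
      "spectral_projection i A ** spectral_projection i A = spectral_projection i A"
    and spectral_projection_eigen:
      "A ** spectral_projection i A = ordered_eigenvalues A $ i *\<^sub>R spectral_projection i A"
proof -
  obtain U where U: "U \<in> unitary_group" "ordered_eigenvalues A \<in> weyl_chamber"
    "A = U ** diag (ordered_eigenvalues A) ** conj_transpose U"
    using simple_diagonalization[OF A] .
  have P: "spectral_projection i A = U ** diag (axis i 1) ** conj_transpose U" for i
    by (rule spectral_projection_eq[OF U])
  show "inner (spectral_projection i A) (spectral_projection j A) = (if i = j then 1 else 0)"
    by (simp add: P inner_unitary_conjugation[OF U(1)] inner_diag_diag inner_axis_axis)
  show "spectral_projection i A \<in> hermitian_matrices"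
    unfolding P by (rule hermitian_unitary_conjugation)
  have "(\<chi> k. axis i 1 $ k * axis i 1 $ k) = (axis i 1 :: (real, 'n) vec)"
    by (simp add: vec_eq_iff axis_def)
  then show "spectral_projection i A ** spectral_projection i A = spectral_projection i A"
    unfolding P unitary_conjugation_mult[OF U(1)] diag_mult_diag by simp
  have "(\<chi> k. ordered_eigenvalues A $ k * axis i 1 $ k)
      = ordered_eigenvalues A $ i *\<^sub>R (axis i 1 :: (real, 'n) vec)"
    by (simp add: vec_eq_iff axis_def)
  then have "(U ** diag (ordered_eigenvalues A) ** conj_transpose U) ** spectral_projection i A
    = U ** diag (ordered_eigenvalues A $ i *\<^sub>R axis i 1) ** conj_transpose U"
    unfolding P unitary_conjugation_mult[OF U(1)] diag_mult_diag by simp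
  also have "\<dots> = ordered_eigenvalues A $ i *\<^sub>R spectral_projection i A"
    unfolding P linear_scale[OF bounded_linear.linear[OF bounded_linear_diag]]
    by (rule linear_scale[OF conjugation_linear])
  finally show "A ** spectral_projection i A
      = ordered_eigenvalues A $ i *\<^sub>R spectral_projection i A"
    using U(3) by simp
qed

lemma Ck_on_spectral_projection:
  fixes i :: "'n::{finite,linorder}"
  assumes ev: "\<And>j. Ck_on k V simple_hermitian
    (\<lambda>A :: ('a::scalar_algebra, 'n) square_matrix. ordered_eigenvalues A $ j)"
  shows "Ck_on k V simple_hermitian
    (spectral_projection i :: ('a, 'n) square_matrix \<Rightarrow> ('a, 'n) square_matrix)"
proof -
  have diff: "Ck_on k V S (\<lambda>x. f x - g x)" if "Ck_on k V S f" "Ck_on k V S g"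
    for S and f g :: "('a, 'n) square_matrix \<Rightarrow> 'b::euclidean_space"
    using Ck_on_add[OF that(1) Ck_on_linear_image[OF bounded_linear_minus[OF bounded_linear_ident]
      that(2)]] by simp
  have "Ck_on k V simple_hermitian (\<lambda>A :: ('a, 'n) square_matrix.
      foldr (\<lambda>j M. inverse (ordered_eigenvalues A $ i - ordered_eigenvalues A $ j) *\<^sub>R
        ((A - ordered_eigenvalues A $ j *\<^sub>R mat 1) ** M)) js (mat 1))" if "i \<notin> set js" for js
    using that
  proof (induction js)
    case (Cons j js)
    have "ordered_eigenvalues A $ i - ordered_eigenvalues A $ j \<noteq> 0"
      if "A \<in> simple_hermitian" for A :: "('a, 'n) square_matrix"
      using weyl_chamber_inj[OF ordered_eigenvalues_weyl[OF that]] Cons.prems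
      by (auto dest: injD)
    then show ?case
      using Cons unfolding foldr.simps o_def
      by (intro Ck_on_bilinear[OF bounded_bilinear_scaleR] Ck_on_inverse diff ev
          Ck_on_bilinear[OF bounded_bilinear_matrix_mult] Ck_on_const
          Ck_on_linear[OF bounded_linear_ident]) auto
  qed simp
  then show ?thesis
    unfolding spectral_projection_def[abs_def] by simp
qed

text \<open>
  Caratheodory's criterion: a difference quotient that is continuous at \<open>x\<close> turns differentiability
  into the computation of a limit.
\<close>

lemma has_derivative_caratheodory:
  fixes f :: "'a::real_normed_vector \<Rightarrow> real" and q :: "'a \<Rightarrow> 'b::real_inner"
  assumes L: "bounded_linear L" and q: "(q \<longlongrightarrow> q0) (at x within S)"
    and ev: "eventually (\<lambda>y. f y - f x = inner (q y) (L (y - x))) (at x within S)"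
  shows "(f has_derivative (\<lambda>h. inner q0 (L h))) (at x within S)"
  unfolding has_derivative_within
proof
  show "bounded_linear (\<lambda>h. inner q0 (L h))"
    using bounded_linear_compose[OF bounded_linear_inner_right L] .
  obtain K where K: "K \<ge> 0" "\<And>h. norm (L h) \<le> norm h * K"
    using bounded_linear.nonneg_bounded[OF L] by blast
  have "((\<lambda>y. norm (q y - q0) * K) \<longlongrightarrow> 0) (at x within S)"
    using tendsto_mult_left_zero[OF tendsto_norm_zero[OF LIM_zero[OF q]]] .
  then show "((\<lambda>y. (1 / norm (y - x)) *\<^sub>R (f y - (f x + inner q0 (L (y - x))))) \<longlongrightarrow> 0)
      (at x within S)"
  proof (rule Lim_null_comparison[rotated], intro eventually_mono[OF ev])
    fix y assume y: "f y - f x = inner (q y) (L (y - x))"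
    have "\<bar>f y - (f x + inner q0 (L (y - x)))\<bar> = \<bar>inner (q y - q0) (L (y - x))\<bar>"
      using y by (simp add: inner_diff_left)
    also have "\<dots> \<le> norm (q y - q0) * norm (L (y - x))" by (rule Cauchy_Schwarz_ineq2)
    also have "\<dots> \<le> norm (q y - q0) * (norm (y - x) * K)"
      by (intro mult_left_mono K(2)) simp
    finally show "norm ((1 / norm (y - x)) *\<^sub>R (f y - (f x + inner q0 (L (y - x)))))
        \<le> norm (q y - q0) * K"
      using K(1) by (cases "y = x") (auto simp: field_simps linear_0[OF bounded_linear.linear[OF L]])
  qed
qed

text \<open>
  Evaluate \<open>P\<^sub>i(B) (B - A) P\<^sub>i(A)\<close>, letting \<open>B\<close> act to the left and \<open>A\<close> to the right. Dividing by the
  inner product, which tends to 1, gives the continuous difference quotient for \<open>\<lambda>\<^sub>i\<close>.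
\<close>

lemma ordered_eigenvalues_difference:
  fixes A B :: "('a::scalar_algebra, 'n::{finite,linorder}) square_matrix"
  assumes A: "A \<in> simple_hermitian" and B: "B \<in> simple_hermitian"
  shows "(ordered_eigenvalues B $ i - ordered_eigenvalues A $ i)
      * inner (spectral_projection i B) (spectral_projection i A)
    = inner (spectral_projection i B) ((B - A) ** spectral_projection i A)"
proof -
  have "inner (spectral_projection i B) (B ** spectral_projection i A)
      = inner (B ** spectral_projection i B) (spectral_projection i A)"
    using B by (simp add: inner_matrix_mult_left simple_hermitian_def hermitian_matrices_def)
  then have "inner (spectral_projection i B) (B ** spectral_projection i A)
      = ordered_eigenvalues B $ i * inner (spectral_projection i B) (spectral_projection i A)"
    by (simp add: spectral_projection_eigen[OF B])
  moreover have "(B - A) ** spectral_projection i A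
      = B ** spectral_projection i A - A ** spectral_projection i A"
    using bounded_bilinear.diff_left[OF bounded_bilinear_matrix_mult] .
  ultimately show ?thesis
    by (simp add: inner_diff_right spectral_projection_eigen[OF A] left_diff_distrib)
qed

lemma has_derivative_ordered_eigenvalues:
  fixes A :: "('a::scalar_algebra, 'n::{finite,linorder}) square_matrix"
  assumes A: "A \<in> simple_hermitian"
  shows "((\<lambda>A. ordered_eigenvalues A $ i) has_derivative
      (\<lambda>B. inner B (spectral_projection i A))) (at A within simple_hermitian)"
proof -
  define P where "P = spectral_projection i A"
  have PP: "inner P P = 1" using spectral_projection_orthonormal[OF A] by (simp add: P_def)
  have "Ck_on 0 hermitian_matrices simple_hermitian
      (spectral_projection i :: _ \<Rightarrow> ('a, 'n) square_matrix)"
    by (rule Ck_on_spectral_projection) (simp add: continuous_on_ordered_eigenvalues)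
  then have lim: "(spectral_projection i \<longlongrightarrow> P) (at A within simple_hermitian)"
    using A by (simp add: P_def continuous_on_def)
  have lim2: "((\<lambda>B. inner (spectral_projection i B) P) \<longlongrightarrow> 1) (at A within simple_hermitian)"
    using tendsto_inner[OF lim tendsto_const[of P]] PP by simp
  have "((\<lambda>A. ordered_eigenvalues A $ i) has_derivative (\<lambda>B. inner P (B ** P)))
    (at A within simple_hermitian)"
  proof (rule has_derivative_caratheodory[where
        q = "\<lambda>B. spectral_projection i B /\<^sub>R inner (spectral_projection i B) P"])
    show "bounded_linear (\<lambda>B :: ('a, 'n) square_matrix. B ** P)"
      by (rule bounded_bilinear.bounded_linear_left[OF bounded_bilinear_matrix_mult])
    show "((\<lambda>B. spectral_projection i B /\<^sub>R inner (spectral_projection i B) P) \<longlongrightarrow> P)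
      (at A within simple_hermitian)"
      using tendsto_scaleR[OF tendsto_inverse[OF lim2] lim] by simp
    have "\<forall>\<^sub>F B in at A within simple_hermitian. inner (spectral_projection i B) P \<noteq> 0"
      using tendsto_imp_eventually_ne[OF lim2, of 0] by simp
    moreover have "\<forall>\<^sub>F B in at A within simple_hermitian. B \<in> simple_hermitian"
      by (simp add: eventually_at_filter)
    ultimately show "\<forall>\<^sub>F B in at A within simple_hermitian.
      ordered_eigenvalues B $ i - ordered_eigenvalues A $ i =
      inner (spectral_projection i B /\<^sub>R inner (spectral_projection i B) P) ((B - A) ** P)"
    proof eventually_elim
      case (elim B)
      then show ?case using ordered_eigenvalues_difference[OF A elim(2), of i]
        by (simp add: P_def field_simps)
    qed
  qed
  moreover have "inner P (B ** P) = inner B P" for B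
    using inner_matrix_mult_right[of B P P] spectral_projection_hermitian[OF A, of i]
      spectral_projection_idem[OF A, of i]
    by (simp add: P_def inner_commute hermitian_matrices_def)
  ultimately show ?thesis by (simp add: P_def)
qed

text \<open>
  Bootstrapping: the gradient of each eigenvalue is a spectral projection, which is as smooth as the
  eigenvalues.
\<close>

lemma Ck_on_ordered_eigenvalues_component:
  "Ck_on k hermitian_matrices simple_hermitian
    (\<lambda>A :: ('a::scalar_algebra, 'n::{finite,linorder}) square_matrix. ordered_eigenvalues A $ i)"
proof (induction k arbitrary: i)
  case 0
  then show ?case by (simp add: continuous_on_ordered_eigenvalues)
next
  case (Suc k)
  show ?case
    by (rule Ck_on_SucI[OF has_derivative_ordered_eigenvalues], assumption)
      (intro Ck_on_linear_image[OF bounded_linear_inner_right] Ck_on_spectral_projection Suc)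
qed

lemma smooth_on_ordered_eigenvalues:
  "smooth_on hermitian_matrices simple_hermitian
    (ordered_eigenvalues :: ('a::scalar_algebra, 'n::{finite,linorder}) square_matrix \<Rightarrow> _)"
proof -
  have "ordered_eigenvalues A = (\<Sum>i\<in>UNIV. ordered_eigenvalues A $ i *\<^sub>R axis i 1)"
    for A :: "('a, 'n) square_matrix"
    by (simp add: vec_eq_iff axis_def if_distrib[of "\<lambda>x. _ * x"] cong: if_cong)
  then have eq: "ordered_eigenvalues = (\<lambda>A :: ('a, 'n) square_matrix.
      \<Sum>i\<in>UNIV. ordered_eigenvalues A $ i *\<^sub>R axis i 1)" by blast
  show ?thesis
    unfolding smooth_on_def
    by (subst eq, intro allI Ck_on_sum Ck_on_bilinear[OF bounded_bilinear_scaleR] Ck_on_const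
        Ck_on_ordered_eigenvalues_component)
qed

definition eigenvalue_differential where
  "eigenvalue_differential A B = (\<chi> i. inner B (spectral_projection i A))"

lemma has_derivative_ordered_eigenvalues_vec:
  fixes A :: "('a::scalar_algebra, 'n::{finite,linorder}) square_matrix"
  assumes A: "A \<in> simple_hermitian"
  shows "(ordered_eigenvalues has_derivative eigenvalue_differential A)
    (at A within simple_hermitian)"
  unfolding has_derivative_componentwise_within[of ordered_eigenvalues] Basis_vec_def
  using has_derivative_ordered_eigenvalues[OF A]
  by (auto simp: eigenvalue_differential_def inner_axis)

section \<open>The horizontal lift\<close>

text \<open>
  The adjoint of the differential of the ordered eigenvalues. Since the spectral projections are
  orthonormal, it is also a right inverse of this differential, with the orthogonal complement of
  the kernel as its range.
\<close>

definition horizontal_lift where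
  "horizontal_lift A u = (\<Sum>i\<in>UNIV. u $ i *\<^sub>R spectral_projection i A)"

context
  fixes A :: "('a::scalar_algebra, 'n::{finite,linorder}) square_matrix"
  assumes A: "A \<in> simple_hermitian"
begin

lemma horizontal_lift_hermitian: "horizontal_lift A u \<in> hermitian_matrices"
  unfolding horizontal_lift_def
  by (intro subspace_sum subspace_scale subspace_hermitian spectral_projection_hermitian A)

lemma eigenvalue_differential_lift: "eigenvalue_differential A (horizontal_lift A u) = u"
  by (simp add: vec_eq_iff eigenvalue_differential_def horizontal_lift_def inner_sum_left
      spectral_projection_orthonormal[OF A] if_distrib[of "\<lambda>x. _ * x"] cong: if_cong)

lemma inner_horizontal_lift:
  "inner (horizontal_lift A u) B = inner u (eigenvalue_differential A B)"
  by (simp add: eigenvalue_differential_def horizontal_lift_def inner_sum_left inner_vec_def[of u])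
    (simp add: inner_commute)

lemma linear_eigenvalue_differential: "linear (eigenvalue_differential A)"
  using has_derivative_ordered_eigenvalues_vec[OF A] by (rule has_derivative_linear)

end

lemma horizontal_lift_diag:
  assumes "l \<in> weyl_chamber"
  shows "horizontal_lift (diag l) u = (diag u :: ('a::scalar_algebra, 'n::{finite,linorder}) square_matrix)"
proof -
  have c: "conj_transpose (mat 1) = (mat 1 :: ('a, 'n) square_matrix)"
    using unitary_mat_1 by (simp add: unitary_group_def)
  have "spectral_projection i (diag l) = (diag (axis i 1) :: ('a, 'n) square_matrix)" for i
    using spectral_projection_eq[OF unitary_mat_1 assms, of "diag l :: ('a, 'n) square_matrix"] by (simp add: c)
  then show ?thesis
    by (simp add: horizontal_lift_def diag_def vec_eq_iff axis_def of_real_def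
        if_distrib[of "\<lambda>x. _ *\<^sub>R x"] if_distrib[of "\<lambda>x. x *\<^sub>R _"] cong: if_cong)
qed

lemma diag_hermitian: "diag u \<in> (hermitian_matrices :: ('a::scalar_algebra^'n^'n) set)"
  by (simp add: hermitian_matrices_def)


section \<open>Manifolds with a single chart\<close>

lemma open_weyl_chamber: "open (weyl_chamber :: (real, 'n::{finite,linorder}) vec set)"
proof -
  have "weyl_chamber = (\<Inter>(i, j)\<in>{(i, j). i < j}. {l :: (real, 'n) vec. l $ j < l $ i})"
    by (auto simp: weyl_chamber_def)
  moreover have "open (\<Inter>(i, j)\<in>{(i, j). i < j}. {l :: (real, 'n) vec. l $ j < l $ i})"
    by (intro open_INT) (auto intro!: open_Collect_less continuous_intros)
  ultimately show ?thesis by simp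
qed

lemma second_countable_euclidean: "second_countable (euclidean :: 'a::second_countable_topology topology)"
proof -
  obtain B :: "'a set set" where "countable B" "topological_basis B" using ex_countable_basis by blast
  then show ?thesis
    unfolding second_countable_def open_openin[symmetric]
    by (intro exI[of _ B]) (meson topological_basisE topological_basis_open)
qed

text \<open>
  The differential is defined by a choice among the derivatives within the coordinate domain, but
  on vectors of the model space this choice makes no difference.
\<close>

lemma differential_eqI:
  assumes f: "(coord_map f C D has_derivative L) (at (snd C p) within coord_domain f C D)"
    and "openin (top_of_set V) (coord_domain f C D)" "subspace V"
    and "p \<in> fst C" "f p \<in> fst D" and v: "v \<in> V"
  shows "differential f C D p v = L v"
proof (rule derivative_unique_on_subspace[OF assms(2,3) _ v _ f])
  show "snd C p \<in> coord_domain f C D" using assms(4,5) by (auto simp: coord_domain_def)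
  show "(coord_map f C D has_derivative differential f C D p)
      (at (snd C p) within coord_domain f C D)"
    unfolding differential_def frechet_derivative_works[symmetric] using f by (rule differentiableI)
qed

lemma single_chart_riemannian_manifold:
  fixes c :: "'m \<Rightarrow> 'e::euclidean_space"
  assumes c: "homeomorphic_map X (top_of_set S) c" and U: "topspace X = U"
    and V: "subspace V" and S: "openin (top_of_set V) S" and g: "inner_product_on V g"
  shows "riemannian_manifold
    \<lparr>mtopology = X, mmodel = V, matlas = {(U, c)}, mmetric = (\<lambda>C p. g)\<rparr>" (is "riemannian_manifold ?M")
proof -
  have im: "c ` U = S"
    using homeomorphic_imp_surjective_map[OF c] U by simp
  have hs: "X homeomorphic_space top_of_set S"
    using c homeomorphic_map_imp_homeomorphic_space by blast
  have dom: "coord_domain id (U, c) (U, c) = S"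
    using im by (auto simp: coord_domain_def)
  have map: "coord_map id (U, c) (U, c) x = x" if "x \<in> S" for x
    using that im by (auto simp: coord_map_def f_inv_into_f)
  have "Ck_on k V S (\<lambda>x. x)" for k
    by (rule Ck_on_linear[OF bounded_linear_ident])
  then have sm: "smooth_on V S (coord_map id (U, c) (U, c))"
    using smooth_on_cong[of S "coord_map id (U, c) (U, c)" "\<lambda>x. x" V] map
    by (simp add: smooth_on_def)
  have "smooth_manifold ?M"
    unfolding smooth_manifold_def
    using homeomorphic_Hausdorff_space[OF hs] homeomorphic_space_second_countability[OF hs]
      second_countable_subtopology[OF second_countable_euclidean, of S]
      Hausdorff_space_subtopology[OF Hausdorff_space_euclidean, of S] U V S c im dom sm
    by auto
  moreover have "differential id (U, c) (U, c) p v = v" if "p \<in> U" "v \<in> V" for p v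
  proof (rule differential_eqI[where L = "\<lambda>v. v"])
    have "c p \<in> S" using im that by auto
    show "(coord_map id (U, c) (U, c) has_derivative (\<lambda>v. v))
        (at (snd (U, c) p) within coord_domain id (U, c) (U, c))"
      unfolding dom snd_conv
      by (rule has_derivative_transform[OF \<open>c p \<in> S\<close> map has_derivative_ident])
  qed (use that V S dom in auto)
  ultimately show ?thesis
    unfolding riemannian_manifold_def using g by (simp add: smooth_on_def)
qed

lemma inner_product_on_inner: "inner_product_on V inner"
  by (auto simp: inner_product_on_def inner_add_left intro: inner_commute)

lemma riemannian_open_rmanifold:
  assumes "subspace V" "openin (top_of_set V) S" "inner_product_on V g"
  shows "riemannian_manifold (open_rmanifold V S g)"
  unfolding open_rmanifold_def
  by (rule single_chart_riemannian_manifold[OF _ _ assms]) (auto simp: homeomorphic_map_id)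

lemma riemannian_weyl_manifold: "riemannian_manifold weyl_manifold"
  unfolding weyl_manifold_def
  by (rule riemannian_open_rmanifold)
    (simp_all add: openin_top_of_set_UNIV open_weyl_chamber inner_product_on_inner)

lemma riemannian_simple_hermitian_manifold:
  "riemannian_manifold
    (simple_hermitian_manifold :: (('a::scalar_algebra, 'n::{finite,linorder}) square_matrix, _) rmanifold)"
proof -
  have "(frobenius :: ('a, 'n) square_matrix \<Rightarrow> _) = inner"
    by (intro ext frobenius_eq_inner)
  then show ?thesis
    unfolding simple_hermitian_manifold_def
    by (intro riemannian_open_rmanifold subspace_hermitian openin_simple_hermitian)
      (simp add: inner_product_on_inner)
qed


section \<open>A Riemannian structure on the orbits\<close>

abbreviation (input) orbit_of_diag :: "(real, 'n::finite) vec \<Rightarrow> ('a::scalar_algebra, 'n) square_matrix set" where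
  "orbit_of_diag l \<equiv> unitary_orbit (diag l)"

lemma inj_on_orbit_of_diag:
  "inj_on (orbit_of_diag :: (real, 'n::{finite,linorder}) vec \<Rightarrow> ('a::scalar_algebra, 'n) square_matrix set)
    weyl_chamber"
  by (auto intro!: inj_onI dest: unitary_orbit_eq_imp)

lemma orbit_of_diag_image:
  "orbit_of_diag ` weyl_chamber
    = unitary_orbit ` (simple_hermitian :: ('a::scalar_algebra, 'n::{finite,linorder}) square_matrix set)"
  using unitary_orbit_ordered_eigenvalues ordered_eigenvalues_weyl diag_simple(1)
  by (metis (no_types, lifting) image_eqI subsetI image_subset_iff subset_antisym)

lemma inv_orbit_of_diag:
  assumes A: "A \<in> (simple_hermitian :: ('a::scalar_algebra, 'n::{finite,linorder}) square_matrix set)"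
  shows "inv_into weyl_chamber orbit_of_diag (unitary_orbit A) = ordered_eigenvalues A"
  using inv_into_f_f[OF inj_on_orbit_of_diag ordered_eigenvalues_weyl[OF A]]
    unitary_orbit_ordered_eigenvalues[OF A] by metis

lemma continuous_diag:
  "continuous_map (top_of_set weyl_chamber)
     (top_of_set (simple_hermitian :: ('a::scalar_algebra, 'n::{finite,linorder}) square_matrix set)) diag"
  by (auto simp: diag_simple(1) intro!: linear_continuous_on bounded_linear_diag)

lemma continuous_map_ordered_eigenvalues:
  "continuous_map
     (top_of_set (simple_hermitian :: ('a::scalar_algebra, 'n::{finite,linorder}) square_matrix set))
     (top_of_set weyl_chamber) ordered_eigenvalues"
proof -
  have "Ck_on 0 hermitian_matrices simple_hermitian
     (ordered_eigenvalues :: ('a, 'n) square_matrix \<Rightarrow> (real, 'n) vec)"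
    using smooth_on_ordered_eigenvalues unfolding smooth_on_def by blast
  then show ?thesis by (auto simp: ordered_eigenvalues_weyl)
qed

text \<open>
  The structure of the Weyl chamber, transported to the orbits. The pullback topology is the one that
  makes the single chart a homeomorphism; it is shown below to be the quotient topology.
\<close>

definition orbit_manifold ::
  "(('a::scalar_algebra, 'n::{finite,linorder}) square_matrix set, (real, 'n) vec) rmanifold" where
  "orbit_manifold = (let O' = orbit_of_diag ` weyl_chamber; c = inv_into weyl_chamber orbit_of_diag in
     \<lparr>mtopology = pullback_topology O' c (top_of_set weyl_chamber), mmodel = UNIV,
      matlas = {(O', c)}, mmetric = (\<lambda>C p. inner)\<rparr>)"

lemma riemannian_quotient_orbit_manifold:
  "riemannian_quotient simple_hermitian_manifold unitary_orbit
    (orbit_manifold :: (('a::scalar_algebra, 'n::{finite,linorder}) square_matrix set, _) rmanifold)"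
proof -
  define \<psi> :: "(real, 'n) vec \<Rightarrow> ('a, 'n) square_matrix set" where "\<psi> = orbit_of_diag"
  define \<kappa> where "\<kappa> = inv_into weyl_chamber \<psi>"
  define X where "X = pullback_topology (\<psi> ` weyl_chamber) \<kappa> (top_of_set weyl_chamber)"
  define S where "S = (simple_hermitian :: ('a, 'n) square_matrix set)"
  define H where "H = (hermitian_matrices :: ('a, 'n) square_matrix set)"
  have Q: "orbit_manifold = \<lparr>mtopology = X, mmodel = UNIV, matlas = {(\<psi> ` weyl_chamber, \<kappa>)},
      mmetric = (\<lambda>C p. inner)\<rparr>"
    by (simp add: orbit_manifold_def Let_def X_def \<kappa>_def \<psi>_def)
  have M: "simple_hermitian_manifold = \<lparr>mtopology = top_of_set S, mmodel = H, matlas = {(S, id)},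
      mmetric = (\<lambda>C p. inner)\<rparr>"
    by (simp add: simple_hermitian_manifold_def open_rmanifold_def S_def H_def frobenius_eq_inner
        fun_eq_iff)
  have \<kappa>\<psi>: "\<kappa> (\<psi> l) = l" if "l \<in> weyl_chamber" for l
    using inv_into_f_f[OF inj_on_orbit_of_diag that] by (simp add: \<kappa>_def \<psi>_def)
  have hm: "homeomorphic_maps X (top_of_set weyl_chamber) \<kappa> \<psi>"
    unfolding homeomorphic_maps_def
  proof (intro conjI ballI)
    show "continuous_map X (top_of_set weyl_chamber) \<kappa>"
      unfolding X_def using continuous_map_pullback[OF continuous_map_id] by (simp add: id_def o_def)
    have "continuous_map (top_of_set weyl_chamber) (top_of_set weyl_chamber) (\<kappa> \<circ> \<psi>)"
      by (rule continuous_map_eq[OF continuous_map_id]) (simp add: \<kappa>\<psi>)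
    then show "continuous_map (top_of_set weyl_chamber) X \<psi>"
      unfolding X_def by (rule continuous_map_pullback') auto
  qed (auto simp: X_def topspace_pullback_topology \<kappa>\<psi>)
  have topX: "topspace X = \<psi> ` weyl_chamber"
    using \<kappa>\<psi> by (auto simp: X_def topspace_pullback_topology)
  have \<kappa>: "homeomorphic_map X (top_of_set weyl_chamber) \<kappa>"
    and \<psi>: "homeomorphic_map (top_of_set weyl_chamber) X \<psi>"
    using hm unfolding homeomorphic_maps_map by auto
  have rQ: "riemannian_manifold (orbit_manifold :: (('a, 'n) square_matrix set, _) rmanifold)"
    unfolding Q by (rule single_chart_riemannian_manifold[OF \<kappa> topX])
      (simp_all add: openin_top_of_set_UNIV open_weyl_chamber inner_product_on_inner)
  \<comment> \<open>\<open>diag\<close> is a continuous section of the eigenvalue map, which is thus a quotient map\<close>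
  have "retraction_maps (top_of_set S) (top_of_set weyl_chamber) ordered_eigenvalues diag"
    unfolding retraction_maps_def S_def
    using continuous_diag continuous_map_ordered_eigenvalues diag_simple(2) by auto
  then have "quotient_map (top_of_set S) (top_of_set weyl_chamber) ordered_eigenvalues"
    using retraction_imp_quotient_map retraction_map_def by blast
  from quotient_map_compose[OF this \<psi>[unfolded homeomorphic_map_def, THEN conjunct1]]
  have qm: "quotient_map (top_of_set S) X unitary_orbit"
    by (rule quotient_map_eq) (simp add: \<psi>_def S_def unitary_orbit_ordered_eigenvalues)
  have \<phi>S: "unitary_orbit A \<in> \<psi> ` weyl_chamber" if "A \<in> S" for A
    using orbit_of_diag_image that unfolding S_def \<psi>_def by blast
  have dom: "coord_domain unitary_orbit (S, id) (\<psi> ` weyl_chamber, \<kappa>) = S"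
    using \<phi>S by (auto simp: coord_domain_def)
  have map: "coord_map unitary_orbit (S, id) (\<psi> ` weyl_chamber, \<kappa>) A = ordered_eigenvalues A"
    if "A \<in> S" for A
  proof -
    have "inv_into S id A = A" using that by (metis f_inv_into_f id_apply image_id)
    then show ?thesis
      using that inv_orbit_of_diag by (simp add: coord_map_def \<kappa>_def \<psi>_def S_def)
  qed
  have diff: "differential unitary_orbit (S, id) (\<psi> ` weyl_chamber, \<kappa>) A B = eigenvalue_differential A B"
    if A: "A \<in> S" and B: "B \<in> H" for A B
  proof (rule differential_eqI)
    have "(coord_map unitary_orbit (S, id) (\<psi> ` weyl_chamber, \<kappa>) has_derivative
        eigenvalue_differential A) (at A within S)"
      by (rule has_derivative_transform[OF A map])
        (use has_derivative_ordered_eigenvalues_vec[of A] A in \<open>simp_all add: S_def\<close>)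
    then show "(coord_map unitary_orbit (S, id) (\<psi> ` weyl_chamber, \<kappa>) has_derivative
        eigenvalue_differential A)
      (at (snd (S, id) A) within coord_domain unitary_orbit (S, id) (\<psi> ` weyl_chamber, \<kappa>))"
      by (simp add: dom)
    show "openin (top_of_set H) (coord_domain unitary_orbit (S, id) (\<psi> ` weyl_chamber, \<kappa>))"
      unfolding dom unfolding S_def H_def by (rule openin_simple_hermitian)
  qed (use A B \<phi>S in \<open>simp_all add: H_def subspace_hermitian\<close>)
  have "smooth_map simple_hermitian_manifold orbit_manifold
      (unitary_orbit :: ('a, 'n) square_matrix \<Rightarrow> _)"
    unfolding smooth_map_def Q M
    using quotient_imp_continuous_map[OF qm] dom smooth_on_ordered_eigenvalues
      smooth_on_cong[of S "coord_map unitary_orbit (S, id) (\<psi> ` weyl_chamber, \<kappa>)"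
        ordered_eigenvalues H] map
    by (simp add: S_def H_def)
  moreover have "eigenvalue_differential A ` H = UNIV" if A: "A \<in> S" for A
    using eigenvalue_differential_lift[of A] horizontal_lift_hermitian[of A] A
    unfolding S_def H_def by (metis surj_def UNIV_eq_I image_eqI)
  moreover have "inner (eigenvalue_differential A u) (eigenvalue_differential A v) = inner u v"
    if A: "A \<in> S" and u: "u \<in> H"
      and hor: "\<And>w. w \<in> H \<Longrightarrow> eigenvalue_differential A w = 0 \<Longrightarrow> inner u w = 0" for A u v
  proof -
    have A': "A \<in> simple_hermitian" using A by (simp add: S_def)
    \<comment> \<open>\<open>w\<close> is the vertical part of \<open>u\<close>; for horizontal \<open>u\<close> it is orthogonal to itself\<close>
    define w where "w = u - horizontal_lift A (eigenvalue_differential A u)"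
    have wH: "w \<in> H"
      unfolding w_def H_def
      by (intro subspace_diff subspace_hermitian horizontal_lift_hermitian A') (use u in \<open>simp add: H_def\<close>)
    have w0: "eigenvalue_differential A w = 0"
      by (simp add: w_def linear_diff[OF linear_eigenvalue_differential[OF A']]
          eigenvalue_differential_lift[OF A'])
    have "inner w w = inner u w - inner (horizontal_lift A (eigenvalue_differential A u)) w"
      by (subst (1) w_def) (simp add: inner_diff_left)
    then have "w = 0" using hor[OF wH w0] by (simp add: inner_horizontal_lift[OF A'] w0)
    then have "u = horizontal_lift A (eigenvalue_differential A u)" by (simp add: w_def)
    then show ?thesis using inner_horizontal_lift[OF A'] by metis
  qed
  ultimately have "riemannian_submersion simple_hermitian_manifold orbit_manifold
      (unitary_orbit :: ('a, 'n) square_matrix \<Rightarrow> _)"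
    unfolding riemannian_submersion_def
    using rQ riemannian_simple_hermitian_manifold[where 'a='a and 'n='n]
    unfolding M Q horizontal_def by (auto simp: diff)
  then show ?thesis
    unfolding riemannian_quotient_def using qm by (simp add: M Q)
qed

section \<open>Riemannian quotients and the Weyl chamber\<close>

text \<open>
  The derivative \<open>L\<close> identifies the domain of \<open>g\<close> with \<open>V\<close>. Precomposing \<open>h\<close> with \<open>L\<close> and
  postcomposing \<open>g\<close> with its left inverse \<open>G\<close> yields mutually inverse maps between open sets of the
  same Euclidean space, to which the inverse function rule applies.
\<close>

lemma has_derivative_inverse_within_subspace:
  fixes g :: "'a::euclidean_space \<Rightarrow> 'e::euclidean_space"
  assumes V: "subspace V" and E: "openin (top_of_set V) E" and h: "continuous_on E h"
    and gh: "\<And>z. z \<in> E \<Longrightarrow> g (h z) = z" and y: "y \<in> E"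
    and g: "(g has_derivative L) (at (h y))" and L: "range L = V"
    and G: "bounded_linear G" and GL: "\<And>u. G (L u) = u"
  shows "(h has_derivative G) (at y within E)"
proof -
  obtain O' where O: "open O'" "E = V \<inter> O'" using E by (auto simp: openin_open)
  have linL: "bounded_linear L" using g by (rule has_derivative_bounded_linear)
  have LG: "L (G z) = z" if "z \<in> V" for z
    using that L GL by (metis rangeE)
  define T where "T = L -` O'"
  have T: "open T"
    unfolding T_def by (intro open_vimage O linear_continuous_on linL)
  have LT: "L z \<in> E \<longleftrightarrow> z \<in> T" for z using O L by (auto simp: T_def)
  have yV: "y \<in> V" using y O by auto
  have yT: "G y \<in> T" using y LT[of "G y"] LG[OF yV] by simp
  have c: "continuous_on T (\<lambda>z. h (L z))"
    by (rule continuous_on_compose2[OF h linear_continuous_on[OF linL]]) (use LT in auto)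
  have "((\<lambda>z. h (L z)) has_derivative id) (at (G y))"
  proof (rule has_derivative_inverse_basic[where f = "\<lambda>z. G (g z)" and f' = id and T = T])
    show "((\<lambda>z. G (g z)) has_derivative id) (at (h (L (G y))))"
      using bounded_linear.has_derivative[OF G g] by (simp add: LG[OF yV] GL id_def)
    show "isCont (\<lambda>z. h (L z)) (G y)"
      using c T yT by (simp add: continuous_on_eq_continuous_at)
    show "G (g (h (L z))) = z" if "z \<in> T" for z
      using gh[of "L z"] LT that GL by simp
  qed (use T yT in \<open>auto simp: id_def intro: bounded_linear_ident\<close>)
  then have "((\<lambda>z. h (L (G z))) has_derivative (\<lambda>v. id (G v))) (at y within E)"
    using has_derivative_compose[OF bounded_linear_imp_has_derivative[OF G]] by blast
  then have "((\<lambda>z. h (L (G z))) has_derivative G) (at y within E)" by simp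
  then show ?thesis
    by (rule has_derivative_transform[OF y, rotated]) (use O LG in auto)
qed

lemma linear_inj_if_range_dim:
  fixes L :: "'a::euclidean_space \<Rightarrow> 'e::euclidean_space"
  assumes L: "linear L" and dim: "DIM('a) \<le> dim (range L)"
  shows "inj L"
proof -
  have sp: "range L = span (L ` Basis)"
    using linear_span_image[OF L, of Basis] by simp
  have card: "card (L ` Basis) \<le> DIM('a)" by (intro card_image_le) simp
  have "dim (range L) \<le> card (L ` Basis)"
    unfolding sp by (rule dim_le_card) auto
  then have eq: "card (L ` Basis) = card (Basis :: 'a set)" "card (L ` Basis) \<le> dim (range L)"
    using card dim by auto
  have "inj_on L Basis" by (rule eq_card_imp_inj_on) (use eq in auto)
  moreover have "independent (L ` Basis)"
    by (rule card_le_dim_spanning[of _ "range L"]) (use sp eq in auto)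
  ultimately have "inj_on L (span Basis)"
    using linear_inj_on_span_iff_independent_image[OF L] by blast
  then show ?thesis by simp
qed

text \<open>
  An arbitrary Riemannian quotient \<open>Q\<close> by the orbit map \<open>\<phi>\<close>, with \<open>\<psi>\<close> the candidate isometry from the
  Weyl chamber to \<open>Q\<close> and \<open>\<kappa>\<close> its inverse.
\<close>

locale orbit_quotient =
  fixes Q :: "(('a::scalar_algebra, 'n::{finite,linorder}) square_matrix set, 'e::euclidean_space) rmanifold"
  assumes quotient: "riemannian_quotient simple_hermitian_manifold unitary_orbit Q"
begin

abbreviation S where "S \<equiv> (simple_hermitian :: ('a, 'n) square_matrix set)"
abbreviation H where "H \<equiv> (hermitian_matrices :: ('a, 'n) square_matrix set)"
abbreviation W where "W \<equiv> (weyl_chamber :: (real, 'n) vec set)"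
abbreviation \<phi> where "\<phi> \<equiv> (unitary_orbit :: ('a, 'n) square_matrix \<Rightarrow> _)"
abbreviation V where "V \<equiv> mmodel Q"

definition \<psi> :: "(real, 'n) vec \<Rightarrow> ('a, 'n) square_matrix set" where
  "\<psi> l = unitary_orbit (diag l)"

definition \<kappa> :: "('a, 'n) square_matrix set \<Rightarrow> (real, 'n) vec" where
  "\<kappa> = inv_into W \<psi>"

lemma hermitian_manifold_simps:
  "mtopology simple_hermitian_manifold = top_of_set S"
  "mmodel simple_hermitian_manifold = H"
  "matlas simple_hermitian_manifold = {(S, id)}"
  "mmetric simple_hermitian_manifold = (\<lambda>C p. inner)"
  by (simp_all add: simple_hermitian_manifold_def open_rmanifold_def frobenius_eq_inner fun_eq_iff)

lemma weyl_manifold_simps: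
  "mtopology weyl_manifold = top_of_set W"
  "mmodel weyl_manifold = (UNIV :: (real, 'n) vec set)"
  "matlas weyl_manifold = {(W, id)}"
  "mmetric weyl_manifold = (\<lambda>C (p :: (real, 'n) vec). inner)"
  by (simp_all add: weyl_manifold_def open_rmanifold_def)

lemma quotient_map: "quotient_map (top_of_set S) (mtopology Q) \<phi>"
  and submersion: "riemannian_submersion simple_hermitian_manifold Q \<phi>"
  and manifold: "riemannian_manifold Q"
  and smooth: "smooth_map simple_hermitian_manifold Q \<phi>"
  using quotient
  by (auto simp: riemannian_quotient_def riemannian_submersion_def hermitian_manifold_simps)

lemma subspace_model: "subspace V"
  using manifold by (simp add: riemannian_manifold_def smooth_manifold_def)

lemma \<kappa>_\<phi>: "A \<in> S \<Longrightarrow> \<kappa> (\<phi> A) = ordered_eigenvalues A"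
  unfolding \<kappa>_def \<psi>_def[abs_def] by (rule inv_orbit_of_diag)

lemma \<phi>_eq: "A \<in> S \<Longrightarrow> \<phi> A = \<psi> (ordered_eigenvalues A)"
  by (simp add: \<psi>_def unitary_orbit_ordered_eigenvalues)

lemma \<kappa>_\<psi>: "l \<in> W \<Longrightarrow> \<kappa> (\<psi> l) = l"
  using \<kappa>_\<phi>[OF diag_simple(1)] diag_simple(2) by (simp add: \<psi>_def)

lemma \<psi>_image: "\<psi> ` W = topspace (mtopology Q)"
  using quotient_imp_surjective_map[OF quotient_map] orbit_of_diag_image[where 'a='a and 'n='n]
  by (simp add: \<psi>_def[abs_def])

lemma \<psi>_\<kappa>: "q \<in> topspace (mtopology Q) \<Longrightarrow> \<psi> (\<kappa> q) = q \<and> \<kappa> q \<in> W"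
  unfolding \<psi>_image[symmetric] by (auto simp: \<kappa>_\<psi>)

lemma continuous_\<psi>: "continuous_map (top_of_set W) (mtopology Q) \<psi>"
  using continuous_map_compose[OF continuous_diag quotient_imp_continuous_map[OF quotient_map]]
  by (simp add: \<psi>_def[abs_def] o_def)

lemma continuous_\<kappa>: "continuous_map (mtopology Q) (top_of_set W) \<kappa>"
  unfolding continuous_compose_quotient_map_eq[OF quotient_map, symmetric]
  by (rule continuous_map_eq[OF continuous_map_ordered_eigenvalues]) (simp add: \<kappa>_\<phi>)

context
  fixes D assumes D: "D \<in> matlas Q"
begin

text \<open>
  The situation in a chart \<open>D\<close> of \<open>Q\<close> with image \<open>E\<close>: the maps \<open>f\<close>, \<open>g\<close> and \<open>h\<close> are the coordinate
  expressions of \<open>\<phi>\<close>, \<open>\<psi>\<close> and \<open>\<kappa>\<close>, defined on \<open>\<Omega>\<close>, \<open>\<Omega>'\<close> and \<open>E\<close>, and \<open>df\<close> and \<open>dg\<close> are the derivatives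
  of \<open>f\<close> and \<open>g\<close>.
\<close>

definition "c = snd D"
definition "\<Omega> = {A \<in> S. \<phi> A \<in> fst D}"
definition "\<Omega>' = {l \<in> W. \<psi> l \<in> fst D}"
definition "E = c ` fst D"
definition "f A = c (\<phi> A)"
definition "g l = c (\<psi> l)"
definition "h x = \<kappa> (inv_into (fst D) c x)"
definition "df A = differential \<phi> (S, id) D A"
definition "dg l u = df (diag l) (diag u)"

lemma chart:
  "openin (mtopology Q) (fst D)" "openin (top_of_set V) E"
  "homeomorphic_map (subtopology (mtopology Q) (fst D)) (top_of_set E) c"
  using manifold D unfolding riemannian_manifold_def smooth_manifold_def E_def c_def
  by (auto simp: case_prod_unfold)

lemma fst_D_subset: "fst D \<subseteq> topspace (mtopology Q)"
  using chart(1) by (rule openin_subset)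

lemma inj_c: "inj_on c (fst D)"
  using homeomorphic_imp_injective_map[OF chart(3)] fst_D_subset by (simp add: Int_absorb1)

lemma openin_\<Omega>: "openin (top_of_set H) \<Omega>"
proof -
  have "openin (top_of_set S) \<Omega>"
    using openin_continuous_map_preimage[OF quotient_imp_continuous_map[OF quotient_map] chart(1)]
    by (simp add: \<Omega>_def)
  then show ?thesis using openin_simple_hermitian openin_trans by blast
qed

lemma open_\<Omega>': "open \<Omega>'"
proof -
  have "openin (top_of_set W) \<Omega>'"
    using openin_continuous_map_preimage[OF continuous_\<psi> chart(1)] by (simp add: \<Omega>'_def)
  then show ?thesis using open_weyl_chamber openin_open_trans by blast
qed

lemma coord_\<phi>:
  "coord_domain \<phi> (S, id) D = \<Omega>" "\<And>A. A \<in> \<Omega> \<Longrightarrow> coord_map \<phi> (S, id) D A = f A"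
proof -
  show "coord_domain \<phi> (S, id) D = \<Omega>" by (auto simp: coord_domain_def \<Omega>_def)
  show "coord_map \<phi> (S, id) D A = f A" if "A \<in> \<Omega>" for A
  proof -
    have "inv_into S id A = A" using that by (metis (lifting) \<Omega>_def mem_Collect_eq f_inv_into_f id_apply image_id)
    then show ?thesis by (simp add: coord_map_def f_def c_def)
  qed
qed

lemma coord_\<psi>:
  "coord_domain \<psi> (W, id) D = \<Omega>'" "\<And>l. l \<in> \<Omega>' \<Longrightarrow> coord_map \<psi> (W, id) D l = g l"
proof -
  show "coord_domain \<psi> (W, id) D = \<Omega>'" by (auto simp: coord_domain_def \<Omega>'_def)
  show "coord_map \<psi> (W, id) D l = g l" if "l \<in> \<Omega>'" for l
  proof -
    have "inv_into W id l = l" using that by (metis (lifting) \<Omega>'_def mem_Collect_eq f_inv_into_f id_apply image_id)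
    then show ?thesis by (simp add: coord_map_def g_def c_def)
  qed
qed

lemma coord_\<kappa>:
  "coord_domain \<kappa> D (W, id) = E" "\<And>x. coord_map \<kappa> D (W, id) x = h x"
  using \<psi>_\<kappa> fst_D_subset by (auto simp: coord_domain_def E_def coord_map_def h_def c_def)

lemma diag_\<Omega>: "l \<in> \<Omega>' \<Longrightarrow> diag l \<in> \<Omega>"
  by (auto simp: \<Omega>_def \<Omega>'_def \<psi>_def diag_simple(1))

lemma g_h: "x \<in> E \<Longrightarrow> g (h x) = x" and h_\<Omega>': "x \<in> E \<Longrightarrow> h x \<in> \<Omega>'"
  and h_g: "l \<in> \<Omega>' \<Longrightarrow> h (g l) = l"
proof -
  assume "x \<in> E"
  then have "inv_into (fst D) c x \<in> fst D" "c (inv_into (fst D) c x) = x"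
    by (auto simp: E_def inv_into_into f_inv_into_f)
  then show "g (h x) = x" "h x \<in> \<Omega>'"
    using \<psi>_\<kappa>[of "inv_into (fst D) c x"] fst_D_subset by (auto simp: g_def h_def \<Omega>'_def)
next
  assume "l \<in> \<Omega>'"
  then show "h (g l) = l" by (simp add: \<Omega>'_def g_def h_def inv_into_f_f[OF inj_c] \<kappa>_\<psi>)
qed

lemma continuous_h: "continuous_on E h"
proof -
  obtain c' where c': "homeomorphic_maps (subtopology (mtopology Q) (fst D)) (top_of_set E) c c'"
    using chart(3) homeomorphic_map_maps by blast
  then have "continuous_map (top_of_set E) (mtopology Q) c'"
    by (auto simp: homeomorphic_maps_def continuous_map_in_subtopology)
  from continuous_map_compose[OF this continuous_\<kappa>] have "continuous_on E (\<kappa> \<circ> c')" by simp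
  moreover have "(\<kappa> \<circ> c') x = h x" if x: "x \<in> E" for x
  proof -
    obtain q where q: "q \<in> fst D" "x = c q" using x by (auto simp: E_def)
    then have "c' x = q" using c' fst_D_subset by (auto simp: homeomorphic_maps_def)
    then show ?thesis using q by (simp add: h_def inv_into_f_f[OF inj_c])
  qed
  ultimately show ?thesis by (simp cong: continuous_on_cong)
qed

lemma smooth_coord_\<phi>: "smooth_on H \<Omega> (coord_map \<phi> (S, id) D)"
  using smooth D by (simp add: smooth_map_def hermitian_manifold_simps flip: coord_\<phi>(1))

lemma has_derivative_f:
  assumes "A \<in> \<Omega>"
  shows "(f has_derivative df A) (at A within \<Omega>)"
proof -
  from smooth_on_has_derivative[OF smooth_coord_\<phi> assms]
  have "(coord_map \<phi> (S, id) D has_derivative df A) (at A within \<Omega>)"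
    by (simp add: df_def differential_def coord_\<phi>(1))
  then show ?thesis by (rule has_derivative_transform[OF assms, rotated]) (simp add: coord_\<phi>(2))
qed

lemma Ck_on_f: "Ck_on k H \<Omega> f"
  using smooth_on_cong[of \<Omega> "coord_map \<phi> (S, id) D" f H] coord_\<phi>(2) smooth_coord_\<phi>
  by (simp add: smooth_on_def)

lemma g_eq: "g l = f (diag l)"
  by (simp add: g_def f_def \<psi>_def)

lemma Ck_on_g: "Ck_on k UNIV \<Omega>' g"
  unfolding g_eq[abs_def]
  by (rule Ck_on_linear_substitution[OF bounded_linear_diag _ _ Ck_on_f])
    (auto simp: diag_\<Omega> diag_hermitian)

lemma has_derivative_g:
  assumes "l \<in> \<Omega>'"
  shows "(g has_derivative dg l) (at l)"
proof -
  have "(g has_derivative dg l) (at l within \<Omega>')"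
    unfolding g_eq[abs_def] dg_def[abs_def]
    by (rule has_derivative_in_compose2[of \<Omega> f df diag \<Omega>'])
      (use assms diag_\<Omega> has_derivative_f bounded_linear_diag in
        \<open>auto intro: bounded_linear_imp_has_derivative\<close>)
  then show ?thesis using assms open_\<Omega>' by (simp only: at_within_open)
qed

lemma Ck_on_dg: "Ck_on k UNIV \<Omega>' (\<lambda>l. dg l u)"
  by (rule Ck_on_SucD[OF _ _ Ck_on_g has_derivative_at_withinI[OF has_derivative_g]])
    (simp_all add: openin_top_of_set_UNIV open_\<Omega>')

lemma differential_\<psi>:
  assumes "l \<in> \<Omega>'"
  shows "differential \<psi> (W, id) D l u = dg l u"
proof (rule differential_eqI[of _ _ _ _ _ UNIV])
  have "(coord_map \<psi> (W, id) D has_derivative dg l) (at l within \<Omega>')"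
    by (rule has_derivative_transform[OF assms coord_\<psi>(2)
          has_derivative_at_withinI[OF has_derivative_g[OF assms]]])
  then show "(coord_map \<psi> (W, id) D has_derivative dg l)
      (at (snd (W, id) l) within coord_domain \<psi> (W, id) D)"
    by (simp add: coord_\<psi>(1))
  show "openin (top_of_set UNIV) (coord_domain \<psi> (W, id) D)"
    by (simp add: coord_\<psi>(1) openin_top_of_set_UNIV open_\<Omega>')
qed (use assms in \<open>auto simp: \<Omega>'_def\<close>)

text \<open>
  The chain rule for \<open>\<phi> = \<psi> \<circ> \<lambda>\<close>, where \<open>\<lambda>\<close> is the map to the ordered eigenvalues.
\<close>

lemma df_eq:
  assumes A: "A \<in> \<Omega>" and B: "B \<in> H"
  shows "df A B = dg (ordered_eigenvalues A) (eigenvalue_differential A B)"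
proof -
  have AS: "A \<in> S" and im: "ordered_eigenvalues ` \<Omega> \<subseteq> \<Omega>'"
    using A by (auto simp: \<Omega>_def \<Omega>'_def ordered_eigenvalues_weyl \<phi>_eq)
  have "(ordered_eigenvalues has_derivative eigenvalue_differential A) (at A within \<Omega>)"
    using has_derivative_ordered_eigenvalues_vec[OF AS] by (rule has_derivative_subset) (auto simp: \<Omega>_def)
  moreover have "(g has_derivative dg (ordered_eigenvalues A)) (at (ordered_eigenvalues A))"
    by (rule has_derivative_g) (use im A in auto)
  ultimately have "((\<lambda>A. g (ordered_eigenvalues A)) has_derivative
      (\<lambda>B. dg (ordered_eigenvalues A) (eigenvalue_differential A B))) (at A within \<Omega>)"
    by (rule has_derivative_compose)
  then have "(f has_derivative (\<lambda>B. dg (ordered_eigenvalues A) (eigenvalue_differential A B)))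
      (at A within \<Omega>)"
    by (rule has_derivative_transform[OF A, rotated]) (simp add: f_def g_def \<Omega>_def \<phi>_eq)
  then show ?thesis
    by (rule derivative_unique_on_subspace[OF openin_\<Omega> subspace_hermitian A B has_derivative_f[OF A]])
qed

lemma submersion_at:
  assumes "A \<in> \<Omega>"
  shows "df A ` H = V"
    and "\<And>u v. u \<in> H \<Longrightarrow> v \<in> H \<Longrightarrow> (\<And>w. w \<in> H \<Longrightarrow> df A w = 0 \<Longrightarrow> inner u w = 0) \<Longrightarrow>
      (\<And>w. w \<in> H \<Longrightarrow> df A w = 0 \<Longrightarrow> inner v w = 0) \<Longrightarrow>
      mmetric Q D (\<phi> A) (df A u) (df A v) = inner u v"
  using submersion D assms
  unfolding riemannian_submersion_def hermitian_manifold_simps horizontal_def df_def \<Omega>_def by auto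

lemma range_dg:
  assumes l: "l \<in> \<Omega>'"
  shows "range (dg l) = V"
proof
  have d: "diag l \<in> \<Omega>" by (rule diag_\<Omega>[OF l])
  have ev: "ordered_eigenvalues (diag l :: ('a, 'n) square_matrix) = l"
    using l diag_simple(2) by (auto simp: \<Omega>'_def)
  show "range (dg l) \<subseteq> V"
    unfolding submersion_at(1)[OF d, symmetric] by (auto simp: dg_def diag_hermitian)
  show "V \<subseteq> range (dg l)"
    unfolding submersion_at(1)[OF d, symmetric] by (auto simp: df_eq[OF d] ev)
qed

text \<open>
  In coordinates, \<open>\<psi>\<close> is a continuous injection of an open subset of \<open>\<real>\<^sup>n\<close> into the model space, so by
  invariance of domain the model space has dimension at least \<open>n\<close>. A linear map from \<open>\<real>\<^sup>n\<close> onto it is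
  then injective.
\<close>

lemma inj_dg:
  assumes l: "l \<in> \<Omega>'"
  shows "inj (dg l)"
proof (rule linear_inj_if_range_dim)
  show "linear (dg l)" using has_derivative_g[OF l] by (rule has_derivative_linear)
  have "dim (UNIV :: (real, 'n) vec set) \<le> dim V"
  proof (rule invariance_of_dimension_subspaces)
    show "openin (top_of_set UNIV) \<Omega>'" by (simp add: openin_top_of_set_UNIV open_\<Omega>')
    show "continuous_on \<Omega>' g" using Ck_on_g[of 0] by simp
    show "g \<in> \<Omega>' \<rightarrow> V" using openin_imp_subset[OF chart(2)] by (auto simp: g_def \<Omega>'_def E_def)
    show "inj_on g \<Omega>'" by (metis h_g inj_onI)
  qed (use l subspace_model in auto)
  then show "DIM((real, 'n) vec) \<le> dim (range (dg l))" by (simp add: range_dg[OF l])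
qed

text \<open>
  Since \<open>dg\<close> is injective, the kernel of \<open>df\<close> at \<open>diag l\<close> is the kernel of the differential of the
  ordered eigenvalues, that is, the hermitian matrices with zero diagonal. Diagonal matrices are
  orthogonal to it, hence horizontal, and the submersion preserves their inner products.
\<close>

lemma mmetric_dg:
  assumes l: "l \<in> \<Omega>'"
  shows "mmetric Q D (\<psi> l) (dg l u) (dg l v) = inner u v"
proof -
  have d: "diag l \<in> \<Omega>" by (rule diag_\<Omega>[OF l])
  have lW: "l \<in> W" using l by (simp add: \<Omega>'_def)
  have ev: "ordered_eigenvalues (diag l :: ('a, 'n) square_matrix) = l"
    by (rule diag_simple(2)[OF lW])
  have hor: "inner (diag u) w = 0" if "w \<in> H" "df (diag l) w = 0" for u w
  proof -
    have "dg l (eigenvalue_differential (diag l) w) = dg l 0"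
      using that df_eq[OF d] linear_0[OF has_derivative_linear[OF has_derivative_g[OF l]]]
      by (simp add: ev)
    then have "eigenvalue_differential (diag l) w = 0" using inj_dg[OF l] by (auto dest: injD)
    then show ?thesis
      using inner_horizontal_lift[OF diag_simple(1)[OF lW], of u w]
      by (simp add: horizontal_lift_diag[OF lW])
  qed
  have "mmetric Q D (\<phi> (diag l)) (df (diag l) (diag u)) (df (diag l) (diag v))
      = inner (diag u) (diag v :: ('a, 'n) square_matrix)"
    by (rule submersion_at(2)[OF d diag_hermitian diag_hermitian hor hor])
  then show ?thesis by (simp add: dg_def \<psi>_def inner_diag_diag)
qed

text \<open>
  As \<open>dg\<close> is a linear isometry onto the model space with the metric of \<open>Q\<close>, its inverse is its
  adjoint. In an orthonormal basis \<open>B\<close> (for the Euclidean structure) of the model space, the adjoint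
  is a polynomial expression in the coefficients of the metric and of
  \<open>dg \<circ> h\<close>. So the derivative of \<open>h\<close> is \<open>C\<^sup>k\<close> whenever \<open>h\<close> is.
\<close>

lemma smooth_h: "smooth_on V E h"
proof -
  obtain B where B: "B \<subseteq> V" "pairwise orthogonal B" "\<And>x. x \<in> B \<Longrightarrow> norm x = 1"
      "independent B" "span B = V"
    using orthonormal_basis_subspace[OF subspace_model] by metis
  have finB: "finite B" using B(4) by (rule independent_imp_finite)
  have expand: "(\<Sum>b\<in>B. inner x b *\<^sub>R b) = x" if "x \<in> V" for x
    by (rule orthonormal_basis_expand[OF B(2,3) _ finB]) (use that B(5) in auto)
  define m where "m x = mmetric Q D (inv_into (fst D) c x)" for x
  have ip: "inner_product_on V (m x)" if "x \<in> E" for x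
    using manifold D inv_into_into[of x c "fst D"] that
    unfolding riemannian_manifold_def m_def E_def by blast
  have m: "Ck_on k V E (\<lambda>x. m x u v)" if "u \<in> V" "v \<in> V" for k u v
    using manifold D that unfolding riemannian_manifold_def m_def E_def c_def smooth_on_def by blast
  have m_add: "m x (u + u') v = m x u v + m x u' v" and m_scale: "m x (r *\<^sub>R u) v = r * m x u v"
    if "x \<in> E" "u \<in> V" "u' \<in> V" "v \<in> V" for x u u' v r
    using ip[OF that(1)] that(2-) unfolding inner_product_on_def by blast+
  have m_sum: "m x (\<Sum>b\<in>B. r b *\<^sub>R b) v = (\<Sum>b\<in>B. r b * m x b v)"
    if "x \<in> E" "v \<in> V" for x v and r :: "'e \<Rightarrow> real"
  proof -
    have z: "m x 0 v = 0"
      using ip[OF that(1)] that(2) subspace_0[OF subspace_model]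
      unfolding inner_product_on_def by (metis mult_zero_left scaleR_zero_left)
    have "finite C \<Longrightarrow> C \<subseteq> B \<Longrightarrow> m x (\<Sum>b\<in>C. r b *\<^sub>R b) v = (\<Sum>b\<in>C. r b * m x b v)" for C
    proof (induction C rule: finite_induct)
      case (insert b C)
      have "r b *\<^sub>R b \<in> V" "b \<in> V" "(\<Sum>b\<in>C. r b *\<^sub>R b) \<in> V"
        using insert.prems B(1) by (auto intro!: subspace_sum subspace_scale subspace_model)
      then show ?case
        using insert m_add[OF that(1) _ _ that(2)] m_scale[OF that(1) _ _ that(2)] by simp
    qed (simp add: z)
    then show ?thesis using finB by blast
  qed
  have m_sym: "m x u v = m x v u" if "x \<in> E" "u \<in> V" "v \<in> V" for x u v
    using ip that unfolding inner_product_on_def by blast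
  \<comment> \<open>the derivative of \<open>h\<close> is the adjoint of \<open>dg\<close> with respect to the two metrics\<close>
  define G where "G x w = (\<Sum>b\<in>B. inner w b *\<^sub>R
    (\<Sum>i\<in>UNIV. (\<Sum>b'\<in>B. inner (dg (h x) (axis i 1)) b' * m x b' b)
      *\<^sub>R (axis i 1 :: (real, 'n) vec)))" for x w
  have dgV: "dg (h x) u \<in> V" if "x \<in> E" for x u
    using range_dg[OF h_\<Omega>'[OF that]] by blast
  have blG: "bounded_linear (G x)" for x
    unfolding G_def[abs_def]
    by (intro bounded_linear_sum bounded_linear_scaleR_left[THEN bounded_linear_compose]
        bounded_linear_inner_left)
  have GL: "G x (dg (h x) u) = u" if x: "x \<in> E" for x u
  proof -
    have mx: "m x (dg (h x) u) (dg (h x) v) = inner u v" for u v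
    proof -
      have "\<psi> (h x) = inv_into (fst D) c x"
        using \<psi>_\<kappa>[of "inv_into (fst D) c x"] fst_D_subset x inv_into_into[of x c "fst D"]
        by (auto simp: h_def E_def)
      then show ?thesis using mmetric_dg[OF h_\<Omega>'[OF x]] by (simp add: m_def)
    qed
    have "(\<Sum>b\<in>B. inner (dg (h x) u) b * (\<Sum>b'\<in>B. inner (dg (h x) (axis i 1)) b' * m x b' b))
        = u $ i" for i
    proof -
      have "(\<Sum>b'\<in>B. inner (dg (h x) (axis i 1)) b' * m x b' b) = m x b (dg (h x) (axis i 1))"
        if "b \<in> B" for b
        using m_sum[OF x, of b] expand[OF dgV[OF x]] that B(1) m_sym[OF x, of b] dgV[OF x]
        by (metis subsetD)
      then have "(\<Sum>b\<in>B. inner (dg (h x) u) b * (\<Sum>b'\<in>B. inner (dg (h x) (axis i 1)) b' * m x b' b))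
        = (\<Sum>b\<in>B. inner (dg (h x) u) b * m x b (dg (h x) (axis i 1)))"
        by simp
      also have "\<dots> = m x (dg (h x) u) (dg (h x) (axis i 1))"
        using m_sum[OF x dgV[OF x]] expand[OF dgV[OF x]] by metis
      also have "\<dots> = u $ i" by (simp add: mx inner_axis)
      finally show ?thesis .
    qed
    then show ?thesis
      by (simp add: G_def vec_eq_iff axis_def if_distrib[of "\<lambda>x. _ * x"] cong: if_cong)
  qed
  have dh: "(h has_derivative G x) (at x within E)" if x: "x \<in> E" for x
    by (rule has_derivative_inverse_within_subspace[OF subspace_model chart(2) continuous_h g_h x
          has_derivative_g range_dg blG GL[OF x]]) (use h_\<Omega>' x in auto)
  have "Ck_on k V E h" for k
  proof (induction k)
    case 0
    then show ?case using continuous_h by simp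
  next
    case (Suc k)
    have "Ck_on k V E (\<lambda>x. dg (h x) u)" for u
      by (rule Ck_on_compose[OF Suc Ck_on_dg]) (use h_\<Omega>' in auto)
    then have "Ck_on k V E (\<lambda>x. G x w)" for w
      unfolding G_def
      by (intro Ck_on_sum Ck_on_bilinear[OF bounded_bilinear_scaleR] Ck_on_const m
          Ck_on_bilinear[OF bounded_bilinear_mult] Ck_on_linear_image[OF bounded_linear_inner_left])
        (use B(1) in auto)
    then show ?case using dh by (intro Ck_on_SucI)
  qed
  then show ?thesis by (simp add: smooth_on_def)
qed

end

theorem isometry: "riemannian_isometry weyl_manifold Q \<psi>"
proof -
  have inv: "inv_into (topspace (mtopology weyl_manifold)) \<psi> = \<kappa>"
    by (simp add: \<kappa>_def weyl_manifold_simps)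
  have bij: "bij_betw \<psi> W (topspace (mtopology Q))"
    using \<psi>_image \<kappa>_\<psi> by (metis bij_betw_def inj_onI)
  have "smooth_on UNIV (coord_domain \<psi> (W, id) D) (coord_map \<psi> (W, id) D)"
    if D: "D \<in> matlas Q" for D
    unfolding coord_\<psi>(1)[OF D]
    using Ck_on_g[OF D] smooth_on_cong[of "\<Omega>' D" "coord_map \<psi> (W, id) D" "g D" UNIV] coord_\<psi>(2)[OF D]
    by (simp add: smooth_on_def)
  moreover have "smooth_on V (coord_domain \<kappa> D (W, id)) (coord_map \<kappa> D (W, id))"
    if D: "D \<in> matlas Q" for D
    unfolding coord_\<kappa>(1)[OF D] using smooth_h[OF D] coord_\<kappa>(2)[OF D] by presburger
  moreover have "mmetric Q D (\<psi> l) (differential \<psi> (W, id) D l u) (differential \<psi> (W, id) D l v)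
      = inner u v" if D: "D \<in> matlas Q" and l: "l \<in> W" "\<psi> l \<in> fst D" for D l u v
  proof -
    have "l \<in> \<Omega>' D" using l by (simp add: \<Omega>'_def[OF D])
    then show ?thesis using mmetric_dg[OF D] differential_\<psi>[OF D] by simp
  qed
  ultimately show ?thesis
    unfolding riemannian_isometry_def smooth_map_def inv
    using manifold riemannian_weyl_manifold bij continuous_\<psi> continuous_\<kappa>
    by (simp add: weyl_manifold_simps)
qed

end

theorem riemannian_isometry_weyl:
  fixes Q :: "(('a::scalar_algebra, 'n::{finite,linorder}) square_matrix set, 'e::euclidean_space) rmanifold"
  assumes "riemannian_quotient simple_hermitian_manifold unitary_orbit Q"
  shows "riemannian_isometry weyl_manifold Q (\<lambda>l. unitary_orbit (diag l))"
proof -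
  interpret orbit_quotient Q using assms by unfold_locales
  show ?thesis using isometry by (simp add: \<psi>_def[abs_def])
qed


section \<open>The orbit space of the simple hermitian matrices\<close>

theorem proposition2p1:
  shows
    "((\<exists>Q :: ((real, 'n::{finite,linorder}) square_matrix set, (real, 'n) vec) rmanifold.
         riemannian_quotient simple_hermitian_manifold unitary_orbit Q) \<and>
      (\<forall>Q :: ((real, 'n) square_matrix set, 'e::euclidean_space) rmanifold.
         riemannian_quotient simple_hermitian_manifold unitary_orbit Q \<longrightarrow>
         riemannian_isometry weyl_manifold Q (\<lambda>l. unitary_orbit (diag l)))) \<and>
     ((\<exists>Q :: ((complex, 'n) square_matrix set, (real, 'n) vec) rmanifold.
         riemannian_quotient simple_hermitian_manifold unitary_orbit Q) \<and>
      (\<forall>Q :: ((complex, 'n) square_matrix set, 'e) rmanifold.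
         riemannian_quotient simple_hermitian_manifold unitary_orbit Q \<longrightarrow>
         riemannian_isometry weyl_manifold Q (\<lambda>l. unitary_orbit (diag l)))) \<and>
     ((\<exists>Q :: ((quaternion, 'n) square_matrix set, (real, 'n) vec) rmanifold.
         riemannian_quotient simple_hermitian_manifold unitary_orbit Q) \<and>
      (\<forall>Q :: ((quaternion, 'n) square_matrix set, 'e) rmanifold.
         riemannian_quotient simple_hermitian_manifold unitary_orbit Q \<longrightarrow>
         riemannian_isometry weyl_manifold Q (\<lambda>l. unitary_orbit (diag l))))"
  by (intro conjI allI impI exI[of _ orbit_manifold] riemannian_quotient_orbit_manifold
      riemannian_isometry_weyl)

end
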